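(* For compositions $\alpha$, $\beta$, $\gamma$, the scaled quasisymmetric powersum basis has a shuffle product and a deconcatenate coproduct: \[ \tilde P_\alpha \tilde P_\beta = \sum_{\gamma \in \alpha\sqcup\!\sqcup\beta} \tilde P_\gamma, \qquad \Delta(\tilde P_\gamma)=\sum_{\alpha|\beta=\gamma}\tilde P_\alpha\otimes \tilde P_\beta. \]
   Context: Work in the Hopf algebra $\mathrm{QSym}$ of quasisymmetric functions with monomial basis $M_\alpha=\sum_{i_1<\dots<i_k}x_{i_1}^{a_1}\cdots x_{i_k}^{a_k}$ for $\alpha=(a_1,\dots,a_k)$. A filling is a matrix with exactly one nonzero entry in every row; $\mathsf{row}(\mathsf{F})$ and $\mathsf{col}(\mathsf{F})$ are the compositions of row sums and (nonempty) column sums. A strict diagonal filling with $\mathsf{row}(\mathsf{F})=\alpha$ has $a_1$ in the upper-left corner, and $a_{i+1}$ is either directly below $a_i$ or southeast of $a_i$ if $a_i\ge a_{i+1}$, and is southeast of $a_i$ otherwise; $\mathsf{SD}(\alpha)$ is the set of these. For each integer $i$, $\sigma_i$ permutes the rows containing entry $i$, such that no row is sent to a row with entry $i$ in the same column; $\sigma=(\sigma_1,\dots,\sigma_n)$ and $\mathfrak{S}_{\mathsf{F}}$ is the set of such tuples for $\mathsf{F}$. The descending quasisymmetric powersum basis is $P_\alpha=\sum_{\mathsf{F}\in\mathsf{SD}(\alpha),\,\sigma\in\mathfrak{S}_{\mathsf{F}}} M_{\mathsf{col}(\sigma(\mathsf{F}))}$. The scaled basis is $\tilde P_\alpha=\frac{1}{z_\alpha}P_\alpha$,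 where $z_\alpha=\prod_i i^{m_i(\alpha)}m_i(\alpha)!$ with $m_i(\alpha)$ the number of parts of $\alpha$ equal to $i$. For compositions $\alpha=(a_1,\dots,a_j)$, $\beta=(b_1,\dots,b_k)$, the concatenation is $\alpha|\beta=(a_1,\dots,a_j,b_1,\dots,b_k)$, and the shuffle $\alpha\sqcup\!\sqcup\beta$ (a multiset of compositions) is defined recursively by $\emptyset\sqcup\!\sqcup\alpha=\alpha\sqcup\!\sqcup\emptyset=\alpha$ and $\alpha\sqcup\!\sqcup\beta=a_1|\big((a_2,\dots,a_j)\sqcup\!\sqcup\beta\big)+b_1|\big(\alpha\sqcup\!\sqcup(b_2,\dots,b_k)\big)$.
   Formalization: The condition on σ_i is corrected: instead of "no row is sent to a row with entry i in the same column" (which forbids the identity and gives P_(1)=0, making the product rule false), σ_i must preserve the relative order of rows with entry i in the same column. *)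

theory Defs
  imports
    "HOL-Library.Multiset"
    "HOL-Library.Poly_Mapping"
    "HOL-Combinatorics.Permutations"
    "Jordan_Normal_Form.Matrix"
begin

section \<open>Compositions and shuffles\<close>

definition composition :: "nat list \<Rightarrow> bool"
  where "composition \<alpha> \<longleftrightarrow> 0 \<notin> set \<alpha>"

fun shuffle :: "nat list \<Rightarrow> nat list \<Rightarrow> nat list multiset"
  where
    "shuffle [] \<beta> = {#\<beta>#}"
  | "shuffle (a # \<alpha>) [] = {#a # \<alpha>#}"
  | "shuffle (a # \<alpha>) (b # \<beta>) =
       image_mset ((#) a) (shuffle \<alpha> (b # \<beta>)) + image_mset ((#) b) (shuffle (a # \<alpha>) \<beta>)"

definition z_comp :: "nat list \<Rightarrow> nat"
  where "z_comp \<alpha> = (\<Prod>i\<in>set \<alpha>. i ^ count_list \<alpha> i * fact (count_list \<alpha> i))"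


section \<open>The ring of quasisymmetric functions\<close>

text \<open>
  A monomial in the variables \<open>x\<^sub>0, x\<^sub>1, x\<^sub>2, \<dots>\<close> is the multiset of the indices of its variables,
  so that multiplication of monomials is addition of multisets. The nonzero exponents of a monomial,
  read in the order of the variables, form a composition.
\<close>

definition exponents :: "nat multiset \<Rightarrow> nat list"
  where "exponents m = map (count m) (sorted_list_of_set (set_mset m))"

text \<open>
  Quasisymmetric functions are the formal power series of bounded degree in which any two monomials
  \<open>x\<^bsub>i\<^sub>1\<^esub>\<^bsup>a\<^sub>1\<^esup> \<cdots> x\<^bsub>i\<^sub>k\<^esub>\<^bsup>a\<^sub>k\<^esup>\<close> (\<open>i\<^sub>1 < \<cdots> < i\<^sub>k\<close>) with the same composition of exponents have the
  same coefficient.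
\<close>

typedef (overloaded) ('k :: zero) qsym =
  "{f :: nat multiset \<Rightarrow> 'k.
      (\<exists>d. \<forall>m. f m \<noteq> 0 \<longrightarrow> size m \<le> d) \<and>
      (\<forall>m m'. exponents m = exponents m' \<longrightarrow> f m = f m')}"
  morphisms coeff_at Abs_qsym
  by (rule exI[of _ "\<lambda>_. 0"]) simp

setup_lifting type_definition_qsym

lemma qsym_eqI: "(\<And>m. coeff_at f m = coeff_at g m) \<Longrightarrow> f = g"
  unfolding coeff_at_inject[symmetric] by (rule ext)

lemma finite_submultisets: "finite {a :: 'a multiset. a \<subseteq># m}"
proof (induction m)
  case empty
  then show ?case by simp
next
  case (add x m)
  have "{a. a \<subseteq># add_mset x m} \<subseteq> {a. a \<subseteq># m} \<union> add_mset x ` {a. a \<subseteq># m}"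
  proof
    fix a assume "a \<in> {a. a \<subseteq># add_mset x m}"
    then have a: "a \<subseteq># add_mset x m" by simp
    show "a \<in> {a. a \<subseteq># m} \<union> add_mset x ` {a. a \<subseteq># m}"
    proof (cases "x \<in># a")
      case True
      then obtain b where "a = add_mset x b" by (metis multi_member_split)
      with a show ?thesis by auto
    next
      case False
      with a have "a \<subseteq># m" by (metis diff_single_trivial subset_eq_diff_conv add_mset_add_single)
      then show ?thesis by simp
    qed
  qed
  with add show ?case by (meson finite_UnI finite_imageI finite_subset)
qed

lemma splittings_eq:
  "{p :: 'a multiset \<times> 'a multiset. fst p + snd p = m} = (\<lambda>a. (a, m - a)) ` {a. a \<subseteq># m}"
  by (auto simp: image_iff)

lemma finite_splittings [simp]: "finite {p :: 'a multiset \<times> 'a multiset. fst p + snd p = m}"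
  unfolding splittings_eq by (intro finite_imageI finite_submultisets)

lemma size_exponents: "sum_list (exponents m) = size m"
  by (simp add: exponents_def sum_list_distinct_conv_sum_set size_multiset_overloaded_eq)

lemma exponents_image_mset:
  assumes "strict_mono_on (set_mset m) \<phi>"
  shows "exponents (image_mset \<phi> m) = exponents m"
proof -
  let ?S = "set_mset m"
  have inj: "inj_on \<phi> ?S" using assms by (rule strict_mono_on_imp_inj_on)
  have "sorted_wrt (<) (map \<phi> (sorted_list_of_set ?S))"
    unfolding sorted_wrt_map
    by (rule sorted_wrt_mono_rel[OF _ strict_sorted_list_of_set])
       (use assms in \<open>auto simp: strict_mono_on_def\<close>)
  then have "sorted_list_of_set (\<phi> ` ?S) = map \<phi> (sorted_list_of_set ?S)"
    by (intro strict_sorted_equal) auto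
  moreover have "count (image_mset \<phi> m) (\<phi> i) = count m i" if "i \<in> ?S" for i
  proof -
    have "\<phi> -` {\<phi> i} \<inter> ?S = {i}" using inj that by (auto dest: inj_onD)
    then show ?thesis by (simp add: count_image_mset)
  qed
  ultimately show ?thesis by (simp add: exponents_def)
qed

lemma exponents_eq_imp_shift:
  assumes "exponents m = exponents m'"
  obtains \<phi> where "strict_mono_on (set_mset m) \<phi>" "image_mset \<phi> m = m'"
proof -
  define xs where "xs = sorted_list_of_set (set_mset m)"
  define ys where "ys = sorted_list_of_set (set_mset m')"
  have xs: "sorted_wrt (<) xs" "distinct xs" "set xs = set_mset m"
    and ys: "sorted_wrt (<) ys" "distinct ys" "set ys = set_mset m'"
    by (simp_all add: xs_def ys_def)
  have eq: "map (count m) xs = map (count m') ys"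
    using assms by (simp add: exponents_def xs_def ys_def)
  then have len: "length xs = length ys" by (metis length_map)
  define \<phi> where "\<phi> x = ys ! (THE i. i < length xs \<and> xs ! i = x)" for x
  have \<phi>: "\<phi> (xs ! i) = ys ! i" if "i < length xs" for i
  proof -
    have "(THE j. j < length xs \<and> xs ! j = xs ! i) = i"
      using that xs(2) by (auto intro!: the_equality simp: nth_eq_iff_index_eq)
    then show ?thesis by (simp add: \<phi>_def)
  qed
  have mono: "strict_mono_on (set_mset m) \<phi>"
    unfolding strict_mono_on_def
  proof (intro allI impI)
    fix r s assume "r \<in> set_mset m \<and> s \<in> set_mset m \<and> r < s"
    then have "r \<in> set xs" "s \<in> set xs" and less: "r < s" by (simp_all add: xs(3))
    then obtain i j where ij: "i < length xs" "r = xs ! i" "j < length xs" "s = xs ! j"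
      by (auto simp: in_set_conv_nth)
    have "i < j"
    proof (rule ccontr)
      assume "\<not> i < j"
      then consider "i = j" | "j < i" by linarith
      then show False
      proof cases
        case 2
        then have "xs ! j < xs ! i" using xs(1) ij by (auto intro: sorted_wrt_nth_less)
        then show False using less ij by simp
      qed (use less ij in simp)
    qed
    then have "ys ! i < ys ! j" using ys(1) ij len by (auto intro: sorted_wrt_nth_less)
    then show "\<phi> r < \<phi> s" using \<phi> ij by simp
  qed
  have inj: "inj_on \<phi> (set_mset m)" using mono by (rule strict_mono_on_imp_inj_on)
  have "map \<phi> xs = ys" using \<phi> len by (auto intro: nth_equalityI)
  then have img: "\<phi> ` set_mset m = set_mset m'" by (metis xs(3) ys(3) set_map)
  have "count (image_mset \<phi> m) y = count m' y" for y
  proof (cases "y \<in># m'")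
    case True
    then obtain i where i: "i < length xs" "y = ys ! i" by (metis ys(3) len in_set_conv_nth)
    have "\<phi> -` {y} \<inter> set_mset m = {xs ! i}"
    proof (intro equalityI subsetI)
      fix x assume "x \<in> \<phi> -` {y} \<inter> set_mset m"
      then have "\<phi> x = \<phi> (xs ! i)" "x \<in> set_mset m" "xs ! i \<in> set_mset m"
        using i(2) \<phi>[OF i(1)] nth_mem[OF i(1)] unfolding xs(3) by simp_all
      with inj show "x \<in> {xs ! i}" by (simp add: inj_onD)
    next
      fix x assume "x \<in> {xs ! i}"
      then show "x \<in> \<phi> -` {y} \<inter> set_mset m"
        using i(2) \<phi>[OF i(1)] nth_mem[OF i(1)] unfolding xs(3) by simp
    qed
    then have "count (image_mset \<phi> m) y = count m (xs ! i)" by (simp add: count_image_mset)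
    also have "\<dots> = count m' (ys ! i)" using eq i len by (metis nth_map)
    finally show ?thesis using i by simp
  next
    case False
    then have "y \<notin># image_mset \<phi> m" using img by auto
    with False show ?thesis by (metis count_inI)
  qed
  then have "image_mset \<phi> m = m'" by (rule multiset_eqI)
  with mono show ?thesis by (rule that)
qed

lemma convolution_shift:
  fixes f g :: "nat multiset \<Rightarrow> 'k :: comm_ring_1"
  assumes f: "\<And>m m'. exponents m = exponents m' \<Longrightarrow> f m = f m'"
    and g: "\<And>m m'. exponents m = exponents m' \<Longrightarrow> g m = g m'"
    and eq: "exponents m = exponents m'"
  shows "(\<Sum>p | fst p + snd p = m. f (fst p) * g (snd p)) =
         (\<Sum>p | fst p + snd p = m'. f (fst p) * g (snd p))"
proof -
  obtain \<phi> where \<phi>: "strict_mono_on (set_mset m) \<phi>" "image_mset \<phi> m = m'"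
    using eq by (rule exponents_eq_imp_shift)
  define \<psi> where "\<psi> = inv_into (set_mset m) \<phi>"
  have inj: "inj_on \<phi> (set_mset m)" using \<phi>(1) by (rule strict_mono_on_imp_inj_on)
  have img: "set_mset m' = \<phi> ` set_mset m" using \<phi>(2) by auto
  have \<psi>\<phi>: "image_mset \<psi> (image_mset \<phi> a) = a" if "set_mset a \<subseteq> set_mset m" for a
  proof -
    have "image_mset (\<psi> \<circ> \<phi>) a = image_mset id a"
      using that inj by (intro image_mset_cong) (auto simp: \<psi>_def)
    then show ?thesis by (simp add: multiset.map_comp)
  qed
  have \<phi>\<psi>: "image_mset \<phi> (image_mset \<psi> a) = a" if "set_mset a \<subseteq> set_mset m'" for a
  proof -
    have "image_mset (\<phi> \<circ> \<psi>) a = image_mset id a"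
      using that by (intro image_mset_cong) (auto simp: \<psi>_def img f_inv_into_f)
    then show ?thesis by (simp add: multiset.map_comp)
  qed
  have mono: "strict_mono_on (set_mset a) \<phi>" if "set_mset a \<subseteq> set_mset m" for a
    using \<phi>(1) that by (auto simp: strict_mono_on_def)
  show ?thesis
  proof (rule sum.reindex_bij_witness[where
        j = "map_prod (image_mset \<phi>) (image_mset \<phi>)" and
        i = "map_prod (image_mset \<psi>) (image_mset \<psi>)"], goal_cases)
    case (1 p)
    then have "set_mset (fst p) \<subseteq> set_mset m" "set_mset (snd p) \<subseteq> set_mset m" by auto
    then show ?case by (cases p) (simp add: \<psi>\<phi>)
  next
    case (2 p)
    then show ?case using \<phi>(2) by (cases p) auto
  next
    case (3 p)
    then have "set_mset (fst p) \<subseteq> set_mset m'" "set_mset (snd p) \<subseteq> set_mset m'" by auto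
    then show ?case by (cases p) (simp add: \<phi>\<psi>)
  next
    case (4 p)
    then have "image_mset \<psi> m' = m" using \<psi>\<phi>[of m] \<phi>(2) by simp
    with 4 show ?case by (cases p) auto
  next
    case (5 p)
    then have "set_mset (fst p) \<subseteq> set_mset m" "set_mset (snd p) \<subseteq> set_mset m" by auto
    then have "exponents (image_mset \<phi> (fst p)) = exponents (fst p)"
      "exponents (image_mset \<phi> (snd p)) = exponents (snd p)"
      by (simp_all add: exponents_image_mset mono)
    then show ?case using f g by (cases p) (metis fst_conv snd_conv map_prod_simp)
  qed
qed

instantiation qsym :: (comm_ring_1) comm_ring_1
begin

lift_definition zero_qsym :: "'a qsym" is "\<lambda>_. 0"
  by simp

lift_definition one_qsym :: "'a qsym" is "\<lambda>m. if m = {#} then 1 else 0"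
proof (intro CollectI conjI, goal_cases)
  case 1
  show ?case by (rule exI[of _ 0]) simp
next
  case 2
  have "m = {#} \<longleftrightarrow> m' = {#}" if "exponents m = exponents m'" for m m'
    using that by (metis size_exponents size_eq_0_iff_empty)
  then show ?case by metis
qed

lift_definition plus_qsym :: "'a qsym \<Rightarrow> 'a qsym \<Rightarrow> 'a qsym" is "\<lambda>f g m. f m + g m"
proof (intro CollectI conjI, goal_cases)
  case (1 f g)
  then obtain d e where "\<forall>m. f m \<noteq> 0 \<longrightarrow> size m \<le> d" "\<forall>m. g m \<noteq> 0 \<longrightarrow> size m \<le> e" by blast
  then have "\<forall>m. f m + g m \<noteq> 0 \<longrightarrow> size m \<le> max d e"
    by (metis add_0 add.right_neutral le_max_iff_disj)
  then show ?case ..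
next
  case (2 f g)
  then have "f m = f m' \<and> g m = g m'" if "exponents m = exponents m'" for m m'
    using that by blast
  then show ?case by metis
qed

lift_definition uminus_qsym :: "'a qsym \<Rightarrow> 'a qsym" is "\<lambda>f m. - f m"
  by (unfold mem_Collect_eq neg_equal_iff_equal neg_equal_0_iff_equal)

definition minus_qsym :: "'a qsym \<Rightarrow> 'a qsym \<Rightarrow> 'a qsym"
  where "minus_qsym f g = f + - g"

lift_definition times_qsym :: "'a qsym \<Rightarrow> 'a qsym \<Rightarrow> 'a qsym"
  is "\<lambda>f g m. \<Sum>p | fst p + snd p = m. f (fst p) * g (snd p)"
proof (intro CollectI conjI, goal_cases)
  case (1 f g)
  then obtain d e where d: "\<And>m. f m \<noteq> 0 \<Longrightarrow> size m \<le> d" and e: "\<And>m. g m \<noteq> 0 \<Longrightarrow> size m \<le> e"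
    by blast
  have "size m \<le> d + e" if "(\<Sum>p | fst p + snd p = m. f (fst p) * g (snd p)) \<noteq> 0" for m
  proof -
    from that obtain p where "p \<in> {p. fst p + snd p = m}" "f (fst p) * g (snd p) \<noteq> 0"
      by (rule sum.not_neutral_contains_not_neutral)
    then have p: "fst p + snd p = m" "f (fst p) \<noteq> 0" "g (snd p) \<noteq> 0" by auto
    have "size m = size (fst p) + size (snd p)" using p(1) by auto
    with d[OF p(2)] e[OF p(3)] show ?thesis by simp
  qed
  then show ?case by blast
next
  case (2 f g)
  then show ?case using convolution_shift[of f g] by blast
qed

instance
proof
  fix a b c :: "'a qsym"
  show "a + b + c = a + (b + c)"
    by (rule qsym_eqI) (simp add: plus_qsym.rep_eq add.assoc)
  show "a + b = b + a"
    by (rule qsym_eqI) (simp add: plus_qsym.rep_eq add.commute)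
  show "0 + a = a"
    by (rule qsym_eqI) (simp add: plus_qsym.rep_eq zero_qsym.rep_eq)
  show "- a + a = 0"
    by (rule qsym_eqI) (simp add: plus_qsym.rep_eq uminus_qsym.rep_eq zero_qsym.rep_eq)
  show "a - b = a + - b"
    by (rule minus_qsym_def)
  have "coeff_at (0 :: 'a qsym) {#} \<noteq> coeff_at 1 {#}"
    by (simp add: zero_qsym.rep_eq one_qsym.rep_eq)
  then show "(0 :: 'a qsym) \<noteq> 1"
    by metis
  show "a * b = b * a"
  proof (rule qsym_eqI)
    fix m
    show "coeff_at (a * b) m = coeff_at (b * a) m"
      unfolding times_qsym.rep_eq
      by (rule sum.reindex_bij_witness[where i = prod.swap and j = prod.swap])
         (auto simp: add.commute mult.commute)
  qed
  show "1 * a = a"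
  proof (rule qsym_eqI)
    fix m
    have "coeff_at (1 * a) m = (\<Sum>p\<in>{({#}, m)}. coeff_at 1 (fst p) * coeff_at a (snd p))"
      unfolding times_qsym.rep_eq by (rule sum.mono_neutral_right) (auto simp: one_qsym.rep_eq)
    then show "coeff_at (1 * a) m = coeff_at a m"
      by (simp add: one_qsym.rep_eq)
  qed
  show "(a + b) * c = a * c + b * c"
    by (rule qsym_eqI) (simp add: times_qsym.rep_eq plus_qsym.rep_eq distrib_right sum.distrib)
  show "a * b * c = a * (b * c)"
  proof (rule qsym_eqI)
    fix m
    have "coeff_at (a * b * c) m =
          (\<Sum>(p, q)\<in>(SIGMA p:{p. fst p + snd p = m}. {q. fst q + snd q = fst p}).
             coeff_at a (fst q) * coeff_at b (snd q) * coeff_at c (snd p))"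
      by (simp add: times_qsym.rep_eq sum_distrib_right sum.Sigma)
    also have "\<dots> =
          (\<Sum>(p, q)\<in>(SIGMA p:{p. fst p + snd p = m}. {q. fst q + snd q = snd p}).
             coeff_at a (fst p) * (coeff_at b (fst q) * coeff_at c (snd q)))"
      by (rule sum.reindex_bij_witness[where
            j = "\<lambda>(p, q). ((fst q, snd q + snd p), (snd q, snd p))" and
            i = "\<lambda>(p, q). ((fst p + fst q, snd q), (fst p, fst q))"])
         (auto simp: add.assoc mult.assoc)
    also have "\<dots> = coeff_at (a * (b * c)) m"
      by (simp add: times_qsym.rep_eq sum_distrib_left sum.Sigma)
    finally show "coeff_at (a * b * c) m = coeff_at (a * (b * c)) m" .
  qed
qed

end

lift_definition scale_qsym :: "'k :: comm_ring_1 \<Rightarrow> 'k qsym \<Rightarrow> 'k qsym" (infixr \<open>*\<^sub>Q\<close> 75)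
  is "\<lambda>c f m. c * f m"
proof (intro CollectI conjI, goal_cases)
  case (1 c f)
  then obtain d where "\<forall>m. f m \<noteq> 0 \<longrightarrow> size m \<le> d" by blast
  then have "\<forall>m. c * f m \<noteq> 0 \<longrightarrow> size m \<le> d" by (metis mult_zero_right)
  then show ?case ..
next
  case (2 c f)
  then have "f m = f m'" if "exponents m = exponents m'" for m m'
    using that by blast
  then show ?case by metis
qed

lift_definition M :: "nat list \<Rightarrow> 'k :: comm_ring_1 qsym"
  is "\<lambda>\<alpha> m. if exponents m = \<alpha> then 1 else 0"
proof (intro CollectI conjI, goal_cases)
  case (1 \<alpha>)
  show ?case by (rule exI[of _ "sum_list \<alpha>"]) (auto simp: size_exponents)
next
  case (2 \<alpha>)
  show ?case by simp
qed


section \<open>The tensor square and the coproduct\<close>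

lemma lookup_map_times:
  "Poly_Mapping.lookup (Poly_Mapping.map ((*) c) x) k = (c :: 'k :: field) * Poly_Mapping.lookup x k"
  by (simp add: Poly_Mapping.map.rep_eq when_def)

interpretation free_pairs: vector_space
  "\<lambda>(c :: 'k :: field) (x :: ('k qsym \<times> 'k qsym) \<Rightarrow>\<^sub>0 'k). Poly_Mapping.map ((*) c) x"
  by (standard; rule poly_mapping_eqI;
      simp only: lookup_add lookup_map_times distrib_left distrib_right mult.assoc mult_1_left)

text \<open>
  The tensor product of \<open>QSym\<close> with itself is the free vector space on the pairs \<open>(f, g)\<close> modulo
  the subspace spanned by the bilinearity relations.
\<close>

abbreviation pair :: "'k :: field qsym \<Rightarrow> 'k qsym \<Rightarrow> ('k qsym \<times> 'k qsym) \<Rightarrow>\<^sub>0 'k"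
  where "pair f g \<equiv> Poly_Mapping.single (f, g) 1"

definition bilinearity_relations :: "(('k :: field qsym \<times> 'k qsym) \<Rightarrow>\<^sub>0 'k) set"
  where "bilinearity_relations =
    {pair (f + f') g - pair f g - pair f' g | f f' g. True} \<union>
    {pair f (g + g') - pair f g - pair f g' | f g g'. True} \<union>
    {pair (c *\<^sub>Q f) g - Poly_Mapping.map ((*) c) (pair f g) | c f g. True} \<union>
    {pair f (c *\<^sub>Q g) - Poly_Mapping.map ((*) c) (pair f g) | c f g. True}"

definition tensor_rel ::
    "(('k :: field qsym \<times> 'k qsym) \<Rightarrow>\<^sub>0 'k) \<Rightarrow> (('k qsym \<times> 'k qsym) \<Rightarrow>\<^sub>0 'k) \<Rightarrow> bool"
  where "tensor_rel x y \<longleftrightarrow> x - y \<in> free_pairs.span bilinearity_relations"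

lemma tensor_rel_refl [simp]: "tensor_rel x x"
  by (simp add: tensor_rel_def free_pairs.span_zero)

lemma tensor_rel_sym: "tensor_rel x y \<Longrightarrow> tensor_rel y x"
  unfolding tensor_rel_def by (drule free_pairs.span_neg) simp

lemma tensor_rel_trans: "tensor_rel x y \<Longrightarrow> tensor_rel y w \<Longrightarrow> tensor_rel x w"
  unfolding tensor_rel_def by (drule (1) free_pairs.span_add) simp

lemma equivp_tensor_rel: "equivp tensor_rel"
  by (blast intro: equivpI reflpI sympI transpI tensor_rel_refl tensor_rel_sym tensor_rel_trans)

quotient_type (overloaded) 'k qsym_tensor =
  "('k :: field qsym \<times> 'k qsym) \<Rightarrow>\<^sub>0 'k" / tensor_rel
  by (rule equivp_tensor_rel)

instantiation qsym_tensor :: (field) ab_group_add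
begin

lift_definition zero_qsym_tensor :: "'a qsym_tensor" is 0 .

lift_definition plus_qsym_tensor :: "'a qsym_tensor \<Rightarrow> 'a qsym_tensor \<Rightarrow> 'a qsym_tensor" is "(+)"
  unfolding tensor_rel_def by (drule (1) free_pairs.span_add) (simp add: algebra_simps)

lift_definition uminus_qsym_tensor :: "'a qsym_tensor \<Rightarrow> 'a qsym_tensor" is uminus
  unfolding tensor_rel_def by (drule free_pairs.span_neg) simp

definition minus_qsym_tensor :: "'a qsym_tensor \<Rightarrow> 'a qsym_tensor \<Rightarrow> 'a qsym_tensor"
  where "minus_qsym_tensor x y = x + - y"

instance
proof
  fix x y w :: "'a qsym_tensor"
  show "x + y + w = x + (y + w)" by transfer (simp add: add.assoc)
  show "x + y = y + x" by transfer (simp add: add.commute)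
  show "0 + x = x" by transfer simp
  show "- x + x = 0" by transfer simp
  show "x - y = x + - y" by (rule minus_qsym_tensor_def)
qed

end

lift_definition scale_tensor :: "'k :: field \<Rightarrow> 'k qsym_tensor \<Rightarrow> 'k qsym_tensor" (infixr \<open>*\<^sub>T\<close> 75)
  is "\<lambda>c. Poly_Mapping.map ((*) c)"
  unfolding tensor_rel_def
  by (drule free_pairs.span_scale) (simp add: free_pairs.scale_right_diff_distrib)

lift_definition tensor :: "'k :: field qsym \<Rightarrow> 'k qsym \<Rightarrow> 'k qsym_tensor" (infixl \<open>\<otimes>\<^sub>Q\<close> 70)
  is pair .

lemma tensor_add_left: "(f + f') \<otimes>\<^sub>Q g = f \<otimes>\<^sub>Q g + f' \<otimes>\<^sub>Q g"
  by transfer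
     (unfold tensor_rel_def bilinearity_relations_def diff_diff_eq[symmetric],
      rule free_pairs.span_base, blast)

lemma tensor_add_right: "f \<otimes>\<^sub>Q (g + g') = f \<otimes>\<^sub>Q g + f \<otimes>\<^sub>Q g'"
  by transfer
     (unfold tensor_rel_def bilinearity_relations_def diff_diff_eq[symmetric],
      rule free_pairs.span_base, blast)

lemma tensor_scale_left: "(c *\<^sub>Q f) \<otimes>\<^sub>Q g = c *\<^sub>T (f \<otimes>\<^sub>Q g)"
  by transfer (unfold tensor_rel_def bilinearity_relations_def, rule free_pairs.span_base, blast)

lemma tensor_scale_right: "f \<otimes>\<^sub>Q (c *\<^sub>Q g) = c *\<^sub>T (f \<otimes>\<^sub>Q g)"
  by transfer (unfold tensor_rel_def bilinearity_relations_def, rule free_pairs.span_base, blast)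

text \<open>
  The coefficient of \<open>M \<alpha>\<close> in \<open>f\<close> is that of the monomial \<open>x\<^sub>0\<^bsup>a\<^sub>1\<^esup> x\<^sub>1\<^bsup>a\<^sub>2\<^esup> \<cdots>\<close> in \<open>f\<close>.
\<close>

definition M_coeff :: "'k :: comm_ring_1 qsym \<Rightarrow> nat list \<Rightarrow> 'k"
  where "M_coeff f \<alpha> = coeff_at f (\<Sum>i<length \<alpha>. replicate_mset (\<alpha> ! i) i)"

definition M_support :: "'k :: comm_ring_1 qsym \<Rightarrow> nat list set"
  where "M_support f = {\<alpha>. composition \<alpha> \<and> M_coeff f \<alpha> \<noteq> 0}"

text \<open>
  The coproduct is the linear map with
  \<open>\<Delta> (M \<gamma>) = (\<Sum>(\<alpha>, \<beta>) | \<alpha> @ \<beta> = \<gamma>. M \<alpha> \<otimes>\<^sub>Q M \<beta>)\<close>; see the lemmas \<open>coproduct_M\<close>,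
  \<open>coproduct_add\<close> and \<open>coproduct_scale\<close>.
\<close>

definition coproduct :: "'k :: field qsym \<Rightarrow> 'k qsym_tensor" (\<open>\<Delta>\<close>)
  where "\<Delta> f = (\<Sum>\<gamma>\<in>M_support f. M_coeff f \<gamma> *\<^sub>T (\<Sum>(\<alpha>, \<beta>) | \<alpha> @ \<beta> = \<gamma>. M \<alpha> \<otimes>\<^sub>Q M \<beta>))"

lemma exponents_packed:
  assumes "composition \<alpha>"
  shows "exponents (\<Sum>i<length \<alpha>. replicate_mset (\<alpha> ! i) i) = \<alpha>"
proof -
  let ?m = "\<Sum>i<length \<alpha>. replicate_mset (\<alpha> ! i) i"
  have count: "count ?m j = (if j < length \<alpha> then \<alpha> ! j else 0)" for j
    by (simp add: count_sum)
  have "set_mset ?m = {0..<length \<alpha>}"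
  proof (rule Set.set_eqI)
    fix j
    show "j \<in># ?m \<longleftrightarrow> j \<in> {0..<length \<alpha>}"
      unfolding count_greater_zero_iff[symmetric] count
      using assms nth_mem[of j \<alpha>] by (auto simp: composition_def simp del: nth_mem intro!: gr0I)
  qed
  then show ?thesis by (auto simp: exponents_def count intro: nth_equalityI)
qed

lemma size_packed: "size (\<Sum>i<length \<alpha>. replicate_mset (\<alpha> ! i) i) = sum_list \<alpha>"
  by (simp add: size_multiset_sum sum_list_sum_nth atLeast0LessThan)

lemma finite_compositions_le: "finite {\<alpha>. composition \<alpha> \<and> sum_list \<alpha> \<le> d}"
proof (rule finite_subset)
  have "length \<alpha> \<le> sum_list \<alpha>" if "composition \<alpha>" for \<alpha>
    using that by (induction \<alpha>) (auto simp: composition_def)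
  then show "{\<alpha>. composition \<alpha> \<and> sum_list \<alpha> \<le> d} \<subseteq> {\<alpha>. set \<alpha> \<subseteq> {..d} \<and> length \<alpha> \<le> d}"
    by (force dest: member_le_sum_list)
  show "finite {\<alpha>. set \<alpha> \<subseteq> {..d} \<and> length \<alpha> \<le> d}" by (rule finite_lists_length_le) simp
qed

lemma finite_M_support [simp]: "finite (M_support f)"
proof -
  obtain d where d: "\<And>m. coeff_at f m \<noteq> 0 \<Longrightarrow> size m \<le> d" using coeff_at[of f] by blast
  have "M_support f \<subseteq> {\<alpha>. composition \<alpha> \<and> sum_list \<alpha> \<le> d}"
    using d by (force simp: M_support_def M_coeff_def size_packed[symmetric] simp del: size_packed)
  then show ?thesis using finite_compositions_le by (rule finite_subset)
qed

lemma scale_tensor_distrib_left: "(a + b) *\<^sub>T x = a *\<^sub>T x + b *\<^sub>T x"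
  by transfer (simp add: free_pairs.scale_left_distrib)

lemma scale_tensor_distrib_right: "a *\<^sub>T (x + y) = a *\<^sub>T x + a *\<^sub>T y"
  by transfer (simp add: free_pairs.scale_right_distrib)

lemma scale_tensor_scale: "a *\<^sub>T (b *\<^sub>T x) = (a * b) *\<^sub>T x"
  by transfer simp

lemma scale_tensor_one [simp]: "1 *\<^sub>T x = x"
  by transfer simp

lemma scale_tensor_zero [simp]: "0 *\<^sub>T x = 0" "a *\<^sub>T 0 = 0"
  using scale_tensor_distrib_left[of 0 0 x] scale_tensor_distrib_right[of a 0 0] by simp_all

lemma scale_tensor_sum: "a *\<^sub>T (\<Sum>i\<in>I. x i) = (\<Sum>i\<in>I. a *\<^sub>T x i)"
  by (induction I rule: infinite_finite_induct) (simp_all add: scale_tensor_distrib_right)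

lemma coproduct_eq_sum:
  assumes "finite S" "M_support f \<subseteq> S" "\<forall>\<gamma>\<in>S. composition \<gamma>"
  shows "\<Delta> f = (\<Sum>\<gamma>\<in>S. M_coeff f \<gamma> *\<^sub>T (\<Sum>(\<alpha>, \<beta>) | \<alpha> @ \<beta> = \<gamma>. M \<alpha> \<otimes>\<^sub>Q M \<beta>))"
  unfolding coproduct_def
  by (rule sum.mono_neutral_left) (use assms in \<open>auto simp: M_support_def\<close>)

lemma M_coeff_add: "M_coeff (f + g) \<alpha> = M_coeff f \<alpha> + M_coeff g \<alpha>"
  by (simp add: M_coeff_def plus_qsym.rep_eq)

lemma M_coeff_scale: "M_coeff (c *\<^sub>Q f) \<alpha> = c * M_coeff f \<alpha>"
  by (simp add: M_coeff_def scale_qsym.rep_eq)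

lemma M_coeff_M: "composition \<alpha> \<Longrightarrow> M_coeff (M \<beta>) \<alpha> = (if \<alpha> = \<beta> then 1 else 0)"
  by (simp add: M_coeff_def M.rep_eq exponents_packed)

lemma coproduct_add: "\<Delta> (f + g) = \<Delta> f + \<Delta> g"
proof -
  let ?S = "M_support f \<union> M_support g"
  have S: "finite ?S" "\<forall>\<gamma>\<in>?S. composition \<gamma>" "M_support (f + g) \<subseteq> ?S"
    by (auto simp: M_support_def M_coeff_add finite_M_support[unfolded M_support_def])
  then show ?thesis
    by (simp add: coproduct_eq_sum[of ?S] M_coeff_add scale_tensor_distrib_left sum.distrib del: finite_Un)
qed

lemma coproduct_scale: "\<Delta> (c *\<^sub>Q f) = c *\<^sub>T \<Delta> f"
proof -
  have "M_support (c *\<^sub>Q f) \<subseteq> M_support f" "\<forall>\<gamma>\<in>M_support f. composition \<gamma>"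
    by (auto simp: M_support_def M_coeff_scale)
  then show ?thesis
    by (simp add: coproduct_eq_sum[of "M_support f"] M_coeff_scale scale_tensor_sum scale_tensor_scale)
qed

lemma coproduct_M:
  assumes "composition \<gamma>"
  shows "\<Delta> (M \<gamma>) = (\<Sum>(\<alpha>, \<beta>) | \<alpha> @ \<beta> = \<gamma>. M \<alpha> \<otimes>\<^sub>Q M \<beta>)"
proof -
  have "M_support (M \<gamma> :: 'a qsym) \<subseteq> {\<gamma>}"
    by (auto simp: M_support_def M_coeff_M split: if_splits)
  then show ?thesis
    using assms by (simp add: coproduct_eq_sum[of "{\<gamma>}"] M_coeff_M)
qed


section \<open>Fillings and the descending powersum basis\<close>

definition filling :: "nat mat \<Rightarrow> bool"
  where "filling F \<longleftrightarrow> (\<forall>r<dim_row F. \<exists>!c. c < dim_col F \<and> F $$ (r, c) \<noteq> 0)"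

definition row_sums :: "nat mat \<Rightarrow> nat list"
  where "row_sums F = map (\<lambda>r. \<Sum>c<dim_col F. F $$ (r, c)) [0..<dim_row F]"

definition col_sums :: "nat mat \<Rightarrow> nat list"
  where "col_sums F =
    filter (\<lambda>s. s \<noteq> 0) (map (\<lambda>c. \<Sum>r<dim_row F. F $$ (r, c)) [0..<dim_col F])"

definition col_of :: "nat mat \<Rightarrow> nat \<Rightarrow> nat"
  where "col_of F r = (THE c. c < dim_col F \<and> F $$ (r, c) \<noteq> 0)"

definition entry :: "nat mat \<Rightarrow> nat \<Rightarrow> nat"
  where "entry F r = F $$ (r, col_of F r)"

text \<open>
  Southeast means one row down and one column to the right. The last conjunct fixes the width of the
  matrix by forbidding superfluous columns of zeros.
\<close>

definition SD :: "nat list \<Rightarrow> nat mat set"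
  where "SD \<alpha> = {F. filling F \<and> row_sums F = \<alpha> \<and>
    (\<alpha> \<noteq> [] \<longrightarrow> col_of F 0 = 0) \<and>
    (\<forall>i. Suc i < length \<alpha> \<longrightarrow>
       (if \<alpha> ! i \<ge> \<alpha> ! Suc i
        then col_of F (Suc i) = col_of F i \<or> col_of F (Suc i) = Suc (col_of F i)
        else col_of F (Suc i) = Suc (col_of F i))) \<and>
    (\<forall>c<dim_col F. \<exists>r<dim_row F. F $$ (r, c) \<noteq> 0)}"

definition rows_with :: "nat mat \<Rightarrow> nat \<Rightarrow> nat set"
  where "rows_with F i = {r. r < dim_row F \<and> entry F r = i}"

text \<open>
  The elements of \<open>row_perms F\<close> are the families of permutations \<open>\<sigma> i\<close>, one for every integer \<open>i\<close>, where \<open>\<sigma> i\<close> is the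
  identity whenever \<open>i\<close> does not occur in \<open>F\<close>. Two rows with the same entry in the same column are
  equal, and permuting them among each other does not count as a permutation of the rows: they must
  keep their relative order. Hence there are
  \<open>m! / (\<Prod>c. m\<^sub>c!)\<close> choices for \<open>\<sigma> i\<close> if \<open>i\<close> occurs \<open>m\<close> times in \<open>F\<close>, and \<open>m\<^sub>c\<close> times in column \<open>c\<close>,
  one for every arrangement of these rows. In particular \<open>P [1, 1, 1, 1]\<close>, which is the fourth power
  of \<open>M [1]\<close>, contains \<open>M [2, 2]\<close> with coefficient \<open>6\<close>. (Merely demanding that no row takes the
  place of a different row with the same entry in the same column would give \<open>9\<close>.)
\<close>

definition row_perms :: "nat mat \<Rightarrow> (nat \<Rightarrow> nat \<Rightarrow> nat) set"
  where "row_perms F = {\<sigma>. \<forall>i. \<sigma> i permutes rows_with F i \<and>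
    (\<forall>r\<in>rows_with F i. \<forall>s\<in>rows_with F i. col_of F r = col_of F s \<longrightarrow> r < s \<longrightarrow> \<sigma> i r < \<sigma> i s)}"

definition row_move :: "nat mat \<Rightarrow> (nat \<Rightarrow> nat \<Rightarrow> nat) \<Rightarrow> nat \<Rightarrow> nat"
  where "row_move F \<sigma> r = (if r < dim_row F then \<sigma> (entry F r) r else r)"

definition act :: "(nat \<Rightarrow> nat \<Rightarrow> nat) \<Rightarrow> nat mat \<Rightarrow> nat mat"
  where "act \<sigma> F = mat (dim_row F) (dim_col F) (\<lambda>(s, c). F $$ (inv_into UNIV (row_move F \<sigma>) s, c))"

definition P :: "nat list \<Rightarrow> 'k :: comm_ring_1 qsym"
  where "P \<alpha> = (\<Sum>(F, \<sigma>)\<in>(SIGMA F:SD \<alpha>. row_perms F). M (col_sums (act \<sigma> F)))"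

definition P_scaled :: "nat list \<Rightarrow> 'k :: field_char_0 qsym"
  where "P_scaled \<alpha> = (1 / of_nat (z_comp \<alpha>)) *\<^sub>Q P \<alpha>"

end

theory Submission
  imports Defs "HOL-Combinatorics.Multiset_Permutations" "HOL-Library.Infinite_Set"
begin

text \<open>
  Permuting rows does not change column sums, so the tuples of permutations only contribute their
  number, a product of multinomial coefficients. After division by \<open>z_comp \<alpha>\<close> the weight of a strict
  diagonal filling factors over its columns: if \<open>\<alpha> = B\<^sub>1 @ \<dots> @ B\<^sub>k\<close> is the corresponding
  factorization into weakly decreasing blocks, it is \<open>1 / (z_comp B\<^sub>1 \<cdots> z_comp B\<^sub>k)\<close>. Hence the
  coefficients of \<open>P_scaled \<alpha>\<close> are iterated convolutions, with respect to deconcatenation, of the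
  functional \<open>\<chi>\<close> with \<open>\<chi> w = 1 / z_comp w\<close> for weakly decreasing \<open>w\<close> and \<open>\<chi> w = 0\<close> otherwise. The
  coproduct formula is immediate from this, and the product formula holds because \<open>\<chi>\<close> is a character
  of the shuffle algebra and deconcatenation is multiplicative for the shuffle product.
\<close>

section \<open>Deconcatenation and shuffles\<close>

lemma splits_Nil: "{(u, v). u @ v = []} = {([], [])}"
  by auto

lemma splits_Cons:
  "{(u, v). u @ v = a # w} = insert ([], a # w) ((\<lambda>(u, v). (a # u, v)) ` {(u, v). u @ v = w})"
  by (auto simp: append_eq_Cons_conv image_iff)

lemma finite_splits [simp]: "finite {(u, v). u @ v = w}"
  by (induction w) (simp_all add: splits_Nil splits_Cons)

lemma finite_splits' [simp]: "finite {p. fst p @ snd p = w}"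
  using finite_splits[of w] by (simp add: case_prod_unfold)

lemma sum_splits_Nil: "(\<Sum>(u, v) | u @ v = []. h u v) = h [] []"
  by (simp add: splits_Nil)

lemma sum_splits_Cons:
  fixes h :: "'a list \<Rightarrow> 'a list \<Rightarrow> 'b :: comm_monoid_add"
  shows "(\<Sum>(u, v) | u @ v = a # w. h u v) = h [] (a # w) + (\<Sum>(u, v) | u @ v = w. h (a # u) v)"
proof -
  have "inj_on (\<lambda>(u, v). (a # u, v)) {(u, v). u @ v = w}" by (auto simp: inj_on_def)
  then show ?thesis
    unfolding splits_Cons
    by (subst sum.insert, simp, force, subst sum.reindex) (simp_all add: case_prod_unfold comp_def)
qed

lemma shuffle_Nil_right [simp]: "shuffle \<alpha> [] = {#\<alpha>#}"
  by (cases \<alpha>) simp_all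

lemma mset_shuffle: "w \<in># shuffle \<alpha> \<beta> \<Longrightarrow> mset w = mset \<alpha> + mset \<beta>"
  by (induction \<alpha> \<beta> arbitrary: w rule: shuffle.induct) auto

lemma set_shuffle: "w \<in># shuffle \<alpha> \<beta> \<Longrightarrow> set w = set \<alpha> \<union> set \<beta>"
  by (drule mset_shuffle) (metis set_mset_mset set_mset_union)

lemma sum_list_shuffle: "w \<in># shuffle \<alpha> \<beta> \<Longrightarrow> sum_list w = sum_list \<alpha> + sum_list \<beta>"
  by (drule mset_shuffle) (metis sum_mset_sum_list sum_mset.union)

lemma count_list_shuffle:
  "w \<in># shuffle \<alpha> \<beta> \<Longrightarrow> count_list w x = count_list \<alpha> x + count_list \<beta> x"
  by (drule mset_shuffle) (metis count_mset count_union)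

text \<open>Compatibility of deconcatenation with the shuffle product, with an arbitrary function
  \<open>h\<close> in place of a tensor. Either the prefix \<open>u\<close> is empty or its first
  letter is the head of \<open>\<alpha>\<close> or of \<open>\<beta>\<close>; the induction
  hypothesis is then applied to \<open>h\<close> with that letter prepended to its first
  argument.\<close>

lemma sum_splits_shuffle:
  fixes h :: "nat list \<Rightarrow> nat list \<Rightarrow> 'b :: comm_monoid_add"
  shows "(\<Sum>w\<in>#shuffle \<alpha> \<beta>. \<Sum>(u, v) | u @ v = w. h u v) =
    (\<Sum>(\<alpha>\<^sub>1, \<alpha>\<^sub>2) | \<alpha>\<^sub>1 @ \<alpha>\<^sub>2 = \<alpha>. \<Sum>(\<beta>\<^sub>1, \<beta>\<^sub>2) | \<beta>\<^sub>1 @ \<beta>\<^sub>2 = \<beta>.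
      \<Sum>u\<in>#shuffle \<alpha>\<^sub>1 \<beta>\<^sub>1. \<Sum>v\<in>#shuffle \<alpha>\<^sub>2 \<beta>\<^sub>2. h u v)"
proof (induction \<alpha> \<beta> arbitrary: h rule: shuffle.induct)
  case (3 a \<alpha> b \<beta>)
  show ?case
    by (simp only: shuffle.simps sum_mset.union image_mset_union multiset.map_comp comp_def
          sum_splits_Cons sum_mset.distrib 3)
      (simp add: sum_splits_Cons sum.distrib case_prod_unfold sum_mset.distrib
        multiset.map_comp comp_def add_ac)
qed (simp_all add: sum_splits_Nil)

section \<open>The character of the shuffle algebra\<close>

definition desc_weight :: "nat list \<Rightarrow> 'k :: field_char_0"
  where "desc_weight w = (if sorted_wrt (\<ge>) w then 1 / of_nat (z_comp w) else 0)"

text \<open>Letters that do not occur contribute the factor 1, so that several words can share one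
  index set.\<close>

lemma z_comp_superset:
  assumes "finite S" "set w \<subseteq> S"
  shows "z_comp w = (\<Prod>i\<in>S. i ^ count_list w i * fact (count_list w i))"
  unfolding z_comp_def
  by (rule prod.mono_neutral_left) (use assms in \<open>auto simp: count_list_0_iff\<close>)

lemma z_comp_Cons: "z_comp (a # w) = a * Suc (count_list w a) * z_comp w"
proof -
  let ?S = "insert a (set w)"
  have "z_comp (a # w) = (\<Prod>i\<in>?S. (if i = a then a * Suc (count_list w a) else 1) *
      (i ^ count_list w i * fact (count_list w i)))"
    unfolding z_comp_def by (intro prod.cong) (auto simp: algebra_simps)
  also have "\<dots> = a * Suc (count_list w a) * z_comp w"
    using z_comp_superset[of ?S w, symmetric]
    by (subst prod.distrib) (simp add: subset_insertI del: mult_Suc_right)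
  finally show ?thesis .
qed

lemma z_comp_Nil [simp]: "z_comp [] = 1"
  by (simp add: z_comp_def)

lemma z_comp_nonzero: "composition w \<Longrightarrow> z_comp w \<noteq> 0"
  by (auto simp: z_comp_def composition_def)

lemma desc_weight_Nil [simp]: "desc_weight [] = 1"
  by (simp add: desc_weight_def)

lemma desc_weight_Cons:
  "desc_weight (a # w) =
    (if \<forall>x\<in>set w. x \<le> a then desc_weight w / of_nat (a * Suc (count_list w a)) else 0)"
  by (simp add: desc_weight_def z_comp_Cons)

lemma sum_mset_cong:
  "(\<And>x. x \<in># A \<Longrightarrow> f x = g x) \<Longrightarrow> (\<Sum>x\<in>#A. f x) = (\<Sum>x\<in>#A. g x)"
  by (metis image_mset_cong)

text \<open>All shuffles of two words have the same letters, so the admissibility of the new head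
  and the factor that it contributes are the same for each of them.\<close>

lemma sum_desc_weight_Cons_shuffle:
  "(\<Sum>w\<in>#shuffle \<alpha> \<beta>. desc_weight (a # w)) =
    (if \<forall>x\<in>set \<alpha> \<union> set \<beta>. x \<le> a
     then (\<Sum>w\<in>#shuffle \<alpha> \<beta>. desc_weight w) / of_nat (a * Suc (count_list \<alpha> a + count_list \<beta> a))
     else 0 :: 'k :: field_char_0)"
proof -
  have "(\<Sum>w\<in>#shuffle \<alpha> \<beta>. desc_weight (a # w) :: 'k) =
      (\<Sum>w\<in>#shuffle \<alpha> \<beta>. desc_weight w *
        (if \<forall>x\<in>set \<alpha> \<union> set \<beta>. x \<le> a
         then 1 / of_nat (a * Suc (count_list \<alpha> a + count_list \<beta> a)) else 0))"
    by (rule sum_mset_cong) (simp add: desc_weight_Cons set_shuffle count_list_shuffle)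
  then show ?thesis
    by (simp add: sum_mset_distrib_right[symmetric] del: of_nat_mult of_nat_add of_nat_Suc)
qed

text \<open>
  \<open>desc_weight\<close> is a character of the shuffle algebra because, for \<open>u\<close> and \<open>v\<close> weakly decreasing,
  exactly \<open>z_comp w / (z_comp u * z_comp v)\<close> of their shuffles are the weakly decreasing word \<open>w\<close>.
\<close>

lemma desc_weight_shuffle:
  assumes "composition \<alpha>" "composition \<beta>"
  shows "(\<Sum>w\<in>#shuffle \<alpha> \<beta>. desc_weight w) = desc_weight \<alpha> * (desc_weight \<beta> :: 'k :: field_char_0)"
  using assms
proof (induction \<alpha> \<beta> rule: shuffle.induct)
  case (3 a \<alpha> b \<beta>)
  then have pos: "a > 0" "b > 0" and comp: "composition \<alpha>" "composition \<beta>"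
    by (auto simp: composition_def)
  have IH: "(\<Sum>w\<in>#shuffle \<alpha> (b # \<beta>). desc_weight w) = desc_weight \<alpha> * (desc_weight (b # \<beta>) :: 'k)"
      "(\<Sum>w\<in>#shuffle (a # \<alpha>) \<beta>. desc_weight w) = desc_weight (a # \<alpha>) * (desc_weight \<beta> :: 'k)"
    using 3 comp by auto
  let ?A = "\<forall>x\<in>set \<alpha>. x \<le> a" and ?B = "\<forall>x\<in>set \<beta>. x \<le> b"
  have exp: "(\<Sum>w\<in>#shuffle (a # \<alpha>) (b # \<beta>). desc_weight w :: 'k) =
      (\<Sum>w\<in>#shuffle \<alpha> (b # \<beta>). desc_weight (a # w)) +
      (\<Sum>w\<in>#shuffle (a # \<alpha>) \<beta>. desc_weight (b # w))"
    by (simp add: multiset.map_comp comp_def)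
  consider "b < a" | "a < b" | "a = b" by linarith
  then show ?case
  proof cases
    case 1
    \<comment> \<open>A decreasing shuffle must start with \<open>a\<close>, so the second sum
      vanishes. In the first, \<open>a\<close> does not occur in \<open>b # \<beta>\<close> when
      that word is decreasing, so the factor is the one from \<open>a # \<alpha>\<close>.\<close>
    then have "count_list \<beta> a = 0" if ?B using that by (auto simp: count_list_0_iff)
    with 1 show ?thesis
      unfolding exp sum_desc_weight_Cons_shuffle IH
      by (auto simp: desc_weight_Cons)
  next
    case 2
    then have "count_list \<alpha> b = 0" if ?A using that by (auto simp: count_list_0_iff)
    with 2 show ?thesis
      unfolding exp sum_desc_weight_Cons_shuffle IH
      by (auto simp: desc_weight_Cons)
  next
    case 3
    show ?thesis
    proof (cases "?A \<and> ?B")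
      case True
      \<comment> \<open>\<open>p\<close> and \<open>q\<close> are the multiplicities of
        \<open>a\<close> in the two words. The two possible heads contribute in proportion to
        \<open>1 / q\<close> and \<open>1 / p\<close>, and
        \<open>(1 / p + 1 / q) / (p + q) = 1 / (p * q)\<close>.\<close>
      define p q :: 'k where "p = of_nat (Suc (count_list \<alpha> a))" "q = of_nat (Suc (count_list \<beta> a))"
      have nz: "p \<noteq> 0" "q \<noteq> 0" "p + q \<noteq> 0" "(of_nat a :: 'k) \<noteq> 0"
        using pos by (simp_all add: p_q_def flip: of_nat_add del: of_nat_Suc)
      have c: "of_nat (a * Suc (count_list \<alpha> a + count_list (a # \<beta>) a)) = of_nat a * (p + q)"
        "of_nat (a * Suc (count_list (a # \<alpha>) a + count_list \<beta> a)) = of_nat a * (p + q)"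
        by (simp_all add: p_q_def algebra_simps)
      have d: "desc_weight (a # \<alpha>) = desc_weight \<alpha> / (of_nat a * p)"
        "desc_weight (a # \<beta>) = desc_weight \<beta> / (of_nat a * q)"
        using True 3 by (simp_all add: desc_weight_Cons p_q_def algebra_simps)
      show ?thesis
        unfolding exp sum_desc_weight_Cons_shuffle IH unfolding 3[symmetric] c d
        using True nz 3 by (auto simp: divide_simps) (simp add: algebra_simps)
    next
      case False
      then show ?thesis
        unfolding exp sum_desc_weight_Cons_shuffle IH using 3
        by (auto simp: desc_weight_Cons)
    qed
  qed
qed simp_all

section \<open>Graded pieces of the character and their convolutions\<close>

definition graded_desc_weight :: "nat \<Rightarrow> nat list \<Rightarrow> 'k :: field_char_0"
  where "graded_desc_weight n w = (if sum_list w = n then desc_weight w else 0)"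

text \<open>Degrees add under shuffling, so only the term \<open>k = sum_list \<alpha>\<close> can
  contribute, and it does so only if the total degree is \<open>n\<close>.\<close>

lemma graded_desc_weight_shuffle:
  assumes "composition \<alpha>" "composition \<beta>"
  shows "(\<Sum>w\<in>#shuffle \<alpha> \<beta>. graded_desc_weight n w) =
    (\<Sum>k\<le>n. graded_desc_weight k \<alpha> * (graded_desc_weight (n - k) \<beta> :: 'k :: field_char_0))"
proof (cases "sum_list \<alpha> + sum_list \<beta> = n")
  case True
  have "(\<Sum>w\<in>#shuffle \<alpha> \<beta>. graded_desc_weight n w :: 'k) = (\<Sum>w\<in>#shuffle \<alpha> \<beta>. desc_weight w)"
    using True by (auto simp: graded_desc_weight_def dest: sum_list_shuffle intro!: sum_mset_cong)
  also have "\<dots> = (\<Sum>k\<in>{sum_list \<alpha>}. graded_desc_weight k \<alpha> * graded_desc_weight (n - k) \<beta>)"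
    using desc_weight_shuffle[OF assms] unfolding True[symmetric] by (simp add: graded_desc_weight_def)
  also have "\<dots> = (\<Sum>k\<le>n. graded_desc_weight k \<alpha> * graded_desc_weight (n - k) \<beta>)"
    using True by (intro sum.mono_neutral_left) (auto simp: graded_desc_weight_def)
  finally show ?thesis .
next
  case False
  have "(\<Sum>w\<in>#shuffle \<alpha> \<beta>. graded_desc_weight n w :: 'k) = (\<Sum>w\<in>#shuffle \<alpha> \<beta>. 0)"
    using False by (intro sum_mset_cong) (auto simp: graded_desc_weight_def dest: sum_list_shuffle)
  moreover have "(\<Sum>k\<le>n. graded_desc_weight k \<alpha> * graded_desc_weight (n - k) \<beta> :: 'k) = 0"
    using False by (intro sum.neutral) (auto simp: graded_desc_weight_def)
  ultimately show ?thesis by simp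
qed

fun desc_coeff :: "nat list \<Rightarrow> nat list \<Rightarrow> 'k :: field_char_0"
  where
    "desc_coeff w [] = (if w = [] then 1 else 0)"
  | "desc_coeff w (n # ns) = (\<Sum>(u, v) | u @ v = w. graded_desc_weight n u * desc_coeff v ns)"

text \<open>The ways of distributing the exponents of a monomial over two factors.\<close>

definition add_splits :: "nat list \<Rightarrow> (nat list \<times> nat list) set"
  where "add_splits ns =
    {(d, e). length d = length ns \<and> length e = length ns \<and> (\<forall>i<length ns. d ! i + e ! i = ns ! i)}"

lemma add_splits_Nil: "add_splits [] = {([], [])}"
  by (auto simp: add_splits_def)

lemma add_splits_Cons:
  "add_splits (n # ns) = (\<lambda>(k, d, e). (k # d, (n - k) # e)) ` ({..n} \<times> add_splits ns)"
proof (intro equalityI subsetI)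
  fix x assume "x \<in> add_splits (n # ns)"
  then obtain k l d e where "x = (k # d, l # e)" "k + l = n" "(d, e) \<in> add_splits ns"
    by (auto simp: add_splits_def length_Suc_conv All_less_Suc2)
  then show "x \<in> (\<lambda>(k, d, e). (k # d, (n - k) # e)) ` ({..n} \<times> add_splits ns)"
    by (intro image_eqI[of _ _ "(k, d, e)"]) auto
qed (auto simp: add_splits_def All_less_Suc2)

lemma sum_add_splits_Cons:
  fixes h :: "nat list \<Rightarrow> nat list \<Rightarrow> 'b :: comm_monoid_add"
  shows "(\<Sum>(d, e)\<in>add_splits (n # ns). h d e) =
    (\<Sum>k\<le>n. \<Sum>(d, e)\<in>add_splits ns. h (k # d) ((n - k) # e))"
proof -
  have "inj_on (\<lambda>(k, d, e). (k # d, (n - k) # e)) ({..n} \<times> add_splits ns)"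
    by (auto simp: inj_on_def)
  then show ?thesis
    unfolding add_splits_Cons
    by (subst sum.reindex) (simp_all add: case_prod_unfold comp_def sum.cartesian_product)
qed

lemma composition_append [simp]: "composition (u @ v) \<longleftrightarrow> composition u \<and> composition v"
  by (auto simp: composition_def)

lemma sum_swap_pair: "(\<Sum>i\<in>A. \<Sum>j\<in>B. \<Sum>k\<in>C. h i j k) = (\<Sum>j\<in>B. \<Sum>k\<in>C. \<Sum>i\<in>A. h i j k)"
  by (subst sum.swap) (intro sum.cong refl sum.swap)

lemma sum_mset_times_sum_mset:
  "(\<Sum>i\<in>#A. f i) * (\<Sum>j\<in>#B. g j) = (\<Sum>i\<in>#A. \<Sum>j\<in>#B. f i * g j :: 'b :: semiring_0)"
  unfolding sum_mset_distrib_right unfolding sum_mset_distrib_left ..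

text \<open>A convolution of characters is again multiplicative: deconcatenation is compatible with
  shuffling, the first block is treated by \<open>graded_desc_weight_shuffle\<close>, and the
  remaining blocks by induction.\<close>

lemma desc_coeff_shuffle:
  assumes "composition \<alpha>" "composition \<beta>"
  shows "(\<Sum>w\<in>#shuffle \<alpha> \<beta>. desc_coeff w ns) =
    (\<Sum>(d, e)\<in>add_splits ns. desc_coeff \<alpha> d * (desc_coeff \<beta> e :: 'k :: field_char_0))"
  using assms
proof (induction ns arbitrary: \<alpha> \<beta>)
  case Nil
  show ?case
  proof (cases "\<alpha> = [] \<and> \<beta> = []")
    case False
    then have "w \<noteq> []" if "w \<in># shuffle \<alpha> \<beta>" for w
      using set_shuffle[OF that] by auto
    then have "(\<Sum>w\<in>#shuffle \<alpha> \<beta>. desc_coeff w [] :: 'k) = (\<Sum>w\<in>#shuffle \<alpha> \<beta>. 0)"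
      by (intro sum_mset_cong) auto
    with False show ?thesis by (auto simp: add_splits_Nil)
  qed (simp add: add_splits_Nil)
next
  case (Cons n ns)
  let ?g = "graded_desc_weight :: nat \<Rightarrow> nat list \<Rightarrow> 'k"
  let ?c = "desc_coeff :: nat list \<Rightarrow> nat list \<Rightarrow> 'k"
  have factor: "(\<Sum>u\<in>#shuffle \<alpha>\<^sub>1 \<beta>\<^sub>1. ?g n u) * (\<Sum>v\<in>#shuffle \<alpha>\<^sub>2 \<beta>\<^sub>2. ?c v ns) =
      (\<Sum>k\<le>n. ?g k \<alpha>\<^sub>1 * ?g (n - k) \<beta>\<^sub>1) * (\<Sum>(d, e)\<in>add_splits ns. ?c \<alpha>\<^sub>2 d * ?c \<beta>\<^sub>2 e)"
    if "composition \<alpha>\<^sub>1" "composition \<alpha>\<^sub>2" "composition \<beta>\<^sub>1" "composition \<beta>\<^sub>2" for \<alpha>\<^sub>1 \<alpha>\<^sub>2 \<beta>\<^sub>1 \<beta>\<^sub>2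
    using that by (simp only: graded_desc_weight_shuffle Cons.IH)
  have "(\<Sum>w\<in>#shuffle \<alpha> \<beta>. ?c w (n # ns)) =
      (\<Sum>(\<alpha>\<^sub>1, \<alpha>\<^sub>2) | \<alpha>\<^sub>1 @ \<alpha>\<^sub>2 = \<alpha>. \<Sum>(\<beta>\<^sub>1, \<beta>\<^sub>2) | \<beta>\<^sub>1 @ \<beta>\<^sub>2 = \<beta>.
        (\<Sum>u\<in>#shuffle \<alpha>\<^sub>1 \<beta>\<^sub>1. ?g n u) * (\<Sum>v\<in>#shuffle \<alpha>\<^sub>2 \<beta>\<^sub>2. ?c v ns))"
    by (simp only: desc_coeff.simps sum_splits_shuffle sum_mset_times_sum_mset)
  also have "\<dots> = (\<Sum>(\<alpha>\<^sub>1, \<alpha>\<^sub>2) | \<alpha>\<^sub>1 @ \<alpha>\<^sub>2 = \<alpha>. \<Sum>(\<beta>\<^sub>1, \<beta>\<^sub>2) | \<beta>\<^sub>1 @ \<beta>\<^sub>2 = \<beta>.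
        (\<Sum>k\<le>n. ?g k \<alpha>\<^sub>1 * ?g (n - k) \<beta>\<^sub>1) * (\<Sum>(d, e)\<in>add_splits ns. ?c \<alpha>\<^sub>2 d * ?c \<beta>\<^sub>2 e))"
    by (intro sum.cong refl; clarify; intro sum.cong refl; clarify; rule factor)
      (use Cons.prems in auto)
  also have "\<dots> = (\<Sum>p | fst p @ snd p = \<alpha>. \<Sum>q | fst q @ snd q = \<beta>. \<Sum>k\<le>n. \<Sum>x\<in>add_splits ns.
        (?g k (fst p) * ?c (snd p) (fst x)) * (?g (n - k) (fst q) * ?c (snd q) (snd x)))"
    by (simp add: case_prod_unfold sum_product mult_ac)
  \<comment> \<open>The sum over \<open>q\<close> and then the sum over \<open>p\<close> move
    inside, where they regroup into values of \<open>desc_coeff\<close>.\<close>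
  also have "\<dots> = (\<Sum>k\<le>n. \<Sum>x\<in>add_splits ns. \<Sum>p | fst p @ snd p = \<alpha>. \<Sum>q | fst q @ snd q = \<beta>.
        (?g k (fst p) * ?c (snd p) (fst x)) * (?g (n - k) (fst q) * ?c (snd q) (snd x)))"
    by (simp only: sum_swap_pair[where A = "{q. fst q @ snd q = \<beta>}"])
      (simp only: sum_swap_pair[where A = "{p. fst p @ snd p = \<alpha>}"])
  also have "\<dots> = (\<Sum>k\<le>n. \<Sum>x\<in>add_splits ns. ?c \<alpha> (k # fst x) * ?c \<beta> ((n - k) # snd x))"
    by (simp add: case_prod_unfold sum_product)
  also have "\<dots> = (\<Sum>(d, e)\<in>add_splits (n # ns). ?c \<alpha> d * ?c \<beta> e)"
    using sum_add_splits_Cons[of "\<lambda>d e. ?c \<alpha> d * ?c \<beta> e" n ns] by (simp only: case_prod_unfold)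
  finally show ?case .
qed

text \<open>Among compositions only the empty word has degree 0, and its weight is 1. A zero
  exponent therefore cuts off an empty prefix and changes nothing.\<close>

lemma desc_coeff_filter_nonzero:
  assumes "composition w"
  shows "desc_coeff w (filter (\<lambda>n. n \<noteq> 0) ns) = (desc_coeff w ns :: 'k :: field_char_0)"
  using assms
proof (induction ns arbitrary: w)
  case (Cons n ns)
  show ?case
  proof (cases "n = 0")
    case True
    have nz: "u = []" if "graded_desc_weight 0 u \<noteq> (0 :: 'k)" "composition u" for u
      using that by (cases u) (auto simp: graded_desc_weight_def composition_def split: if_splits)
    have "desc_coeff w (0 # ns) =
        (\<Sum>(u, v)\<in>{([], w)}. graded_desc_weight 0 u * desc_coeff v ns :: 'k)"
      unfolding desc_coeff.simps using Cons.prems by (intro sum.mono_neutral_right) (auto dest: nz)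
    with True Cons show ?thesis by (simp add: graded_desc_weight_def)
  next
    case False
    then show ?thesis using Cons by (auto intro!: sum.cong)
  qed
qed simp

section \<open>Sums over factorizations into blocks\<close>

definition desc_weight_list :: "nat list list \<Rightarrow> 'k :: field_char_0"
  where "desc_weight_list Bs = (\<Prod>B\<leftarrow>Bs. desc_weight B)"

definition factorizations :: "'a list \<Rightarrow> 'a list list set"
  where "factorizations w = {Bs. concat Bs = w \<and> [] \<notin> set Bs}"

text \<open>Empty blocks can be inserted freely, so finiteness needs a bound on the number of
  blocks.\<close>

lemma finite_concat_length: "finite {Bs. concat Bs = w \<and> length Bs \<le> n}"
proof (rule finite_subset)
  let ?S = "{B. set B \<subseteq> set w \<and> length B \<le> length w}"
  show "{Bs. concat Bs = w \<and> length Bs \<le> n} \<subseteq> {Bs. set Bs \<subseteq> ?S \<and> length Bs \<le> n}"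
    by (auto simp: length_concat intro!: member_le_sum_list)
  show "finite {Bs. set Bs \<subseteq> ?S \<and> length Bs \<le> n}"
    by (intro finite_lists_length_le) simp_all
qed

lemma length_le_concat: "[] \<notin> set Bs \<Longrightarrow> length Bs \<le> length (concat Bs)"
proof (induction Bs)
  case (Cons B Bs)
  then show ?case by (cases B) auto
qed simp

lemma finite_factorizations [simp]: "finite (factorizations w)"
  by (rule finite_subset[OF _ finite_concat_length[of w "length w"]])
     (auto simp: factorizations_def dest: length_le_concat)

text \<open>Unrolling the recursion cuts off the blocks one after another. Blocks may be empty here,
  since \<open>ns\<close> may contain zeros.\<close>

lemma desc_coeff_eq_sum:
  "(desc_coeff w ns :: 'k :: field_char_0) = (\<Sum>Bs | concat Bs = w \<and> map sum_list Bs = ns. desc_weight_list Bs)"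
proof (induction ns arbitrary: w)
  case Nil
  have "{Bs :: nat list list. concat Bs = w \<and> map sum_list Bs = []} = (if w = [] then {[]} else {})"
    by auto
  then show ?case by (simp add: desc_weight_list_def)
next
  case (Cons n ns)
  have fin: "finite {Bs. concat Bs = v \<and> map sum_list Bs = ns}" for v
    by (rule finite_subset[OF _ finite_concat_length[of v "length ns"]]) auto
  have "(desc_coeff w (n # ns) :: 'k) = (\<Sum>(u, v) | u @ v = w. \<Sum>Bs | concat Bs = v \<and> map sum_list Bs = ns.
      graded_desc_weight n u * desc_weight_list Bs)"
    by (simp add: Cons sum_distrib_left case_prod_unfold)
  also have "\<dots> = (\<Sum>(p, Bs)\<in>(SIGMA p:{(u, v). u @ v = w}. {Bs. concat Bs = snd p \<and> map sum_list Bs = ns}).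
      graded_desc_weight n (fst p) * desc_weight_list Bs)"
    using fin by (simp add: sum.Sigma case_prod_unfold)
  also have "\<dots> = (\<Sum>(p, Bs)\<in>(SIGMA p:{(u, v). u @ v = w \<and> sum_list u = n}.
        {Bs. concat Bs = snd p \<and> map sum_list Bs = ns}).
      graded_desc_weight n (fst p) * desc_weight_list Bs)"
  proof (intro sum.mono_neutral_right)
    show "finite (SIGMA p:{(u, v). u @ v = w}. {Bs. concat Bs = snd p \<and> map sum_list Bs = ns})"
      using fin by (intro finite_SigmaI) auto
  qed (auto simp: graded_desc_weight_def split: if_splits)
  also have "\<dots> = (\<Sum>Bs | concat Bs = w \<and> map sum_list Bs = n # ns. desc_weight_list Bs)"
    \<comment> \<open>The prefix becomes the head block, and the suffix is recovered by
      concatenating the tail.\<close>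
    by (rule sum.reindex_bij_witness[where
          j = "\<lambda>(p, Bs). fst p # Bs" and i = "\<lambda>Bs. ((hd Bs, concat (tl Bs)), tl Bs)"])
       (auto simp: graded_desc_weight_def desc_weight_list_def)
  finally show ?case .
qed

text \<open>Closed form of \<open>P_scaled\<close> on compositions. Running over all factorizations
  costs nothing, because \<open>desc_weight\<close> vanishes on blocks that are not weakly
  decreasing, and it fits deconcatenation.\<close>

definition desc_powersum :: "nat list \<Rightarrow> 'k :: field_char_0 qsym"
  where "desc_powersum \<alpha> = (\<Sum>Bs\<in>factorizations \<alpha>. desc_weight_list Bs *\<^sub>Q M (map sum_list Bs))"

lemma coeff_at_sum: "coeff_at (\<Sum>i\<in>I. f i) m = (\<Sum>i\<in>I. coeff_at (f i) m)"
  by (induction I rule: infinite_finite_induct) (simp_all add: zero_qsym.rep_eq plus_qsym.rep_eq)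

lemma coeff_at_sum_mset: "coeff_at (\<Sum>i\<in>#I. f i) m = (\<Sum>i\<in>#I. coeff_at (f i) m)"
  by (induction I) (simp_all add: zero_qsym.rep_eq plus_qsym.rep_eq)

lemma zero_notin_exponents: "0 \<notin> set (exponents m)"
  by (auto simp: exponents_def count_eq_zero_iff)

lemma coeff_at_desc_powersum: "coeff_at (desc_powersum \<alpha>) m = desc_coeff \<alpha> (exponents m)"
proof -
  have "coeff_at (desc_powersum \<alpha>) m =
      (\<Sum>Bs\<in>factorizations \<alpha>. if exponents m = map sum_list Bs then desc_weight_list Bs else 0)"
    unfolding desc_powersum_def coeff_at_sum
    by (intro sum.cong) (auto simp: scale_qsym.rep_eq M.rep_eq)
  also have "\<dots> = (\<Sum>Bs | Bs \<in> factorizations \<alpha> \<and> exponents m = map sum_list Bs. desc_weight_list Bs)"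
    by (rule sum.inter_filter[symmetric]) simp
  finally have *: "coeff_at (desc_powersum \<alpha>) m = \<dots>" .
  \<comment> \<open>Exponents are nonzero, which rules out empty blocks and reconciles the two index
    sets.\<close>
  have "[] \<notin> set Bs" if "map sum_list Bs = exponents m" for Bs
    using zero_notin_exponents[of m] unfolding that[symmetric] by force
  then have "{Bs \<in> factorizations \<alpha>. exponents m = map sum_list Bs} =
      {Bs. concat Bs = \<alpha> \<and> map sum_list Bs = exponents m}"
    by (auto simp: factorizations_def)
  with * show ?thesis by (simp add: desc_coeff_eq_sum)
qed

section \<open>Product formula via exponent vectors\<close>

lemma exponents_eq_filter:
  assumes "finite S" "set_mset m \<subseteq> S"
  shows "exponents m = filter (\<lambda>n. n \<noteq> 0) (map (count m) (sorted_list_of_set S))"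
proof -
  have "filter (\<lambda>x. count m x \<noteq> 0) (sorted_list_of_set S) = sorted_list_of_set (set_mset m)"
    using assms by (intro strict_sorted_equal sorted_wrt_filter) (auto simp: count_eq_zero_iff)
  then show ?thesis by (simp add: exponents_def filter_map comp_def)
qed

lemma ex_multiset_counts:
  assumes "length d = length xs" "distinct xs"
  shows "\<exists>a. set_mset a \<subseteq> set xs \<and> map (count a) xs = d"
  using assms
proof (induction d xs rule: list_induct2)
  case (Cons n d x xs)
  then obtain a where a: "set_mset a \<subseteq> set xs" "map (count a) xs = d" by auto
  moreover have "count a x = 0" using a Cons.prems by (auto simp: count_eq_zero_iff)
  ultimately show ?case
    using Cons.prems
    by (intro exI[of _ "a + replicate_mset n x"]) (auto simp: set_mset_replicate_mset_subset split: if_splits)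
qed simp

text \<open>A divisor of \<open>m\<close> involves only the variables in \<open>xs\<close> and is
  determined by its exponents there, and every exponent vector is realized by some monomial.\<close>

lemma bij_betw_add_splits:
  fixes m :: "nat multiset"
  defines "xs \<equiv> sorted_list_of_set (set_mset m)"
  shows "bij_betw (\<lambda>p. (map (count (fst p)) xs, map (count (snd p)) xs))
    {p. fst p + snd p = m} (add_splits (map (count m) xs))"
proof -
  have xs: "set xs = set_mset m" "distinct xs" by (simp_all add: xs_def)
  have eqI: "a = b" if "set_mset a \<subseteq> set xs" "set_mset b \<subseteq> set xs" "map (count a) xs = map (count b) xs"
    for a b :: "nat multiset"
  proof (rule multiset_eqI)
    fix x show "count a x = count b x"
      using that by (cases "x \<in> set xs") (auto simp: map_eq_conv, metis count_inI subsetD)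
  qed
  show ?thesis
    unfolding bij_betw_def
  proof (intro conjI equalityI subsetI)
    show "inj_on (\<lambda>p. (map (count (fst p)) xs, map (count (snd p)) xs)) {p. fst p + snd p = m}"
    proof (rule inj_onI, elim CollectE Pair_inject)
      fix p q assume *: "fst p + snd p = m" "fst q + snd q = m"
        "map (count (fst p)) xs = map (count (fst q)) xs" "map (count (snd p)) xs = map (count (snd q)) xs"
      have sub: "set_mset (fst r) \<subseteq> set xs" "set_mset (snd r) \<subseteq> set xs" if "fst r + snd r = m" for r
        unfolding xs(1) that[symmetric] by simp_all
      show "p = q"
        by (intro prod_eqI eqI sub *)
    qed
  next
    fix y assume "y \<in> (\<lambda>p. (map (count (fst p)) xs, map (count (snd p)) xs)) ` {p. fst p + snd p = m}"
    then show "y \<in> add_splits (map (count m) xs)"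
      by (auto simp: add_splits_def)
  next
    fix y assume "y \<in> add_splits (map (count m) xs)"
    then obtain d e where y: "y = (d, e)" and len: "length d = length xs" "length e = length xs"
      and sum: "\<forall>i<length xs. d ! i + e ! i = count m (xs ! i)"
      by (auto simp: add_splits_def)
    obtain a b where a: "set_mset a \<subseteq> set xs" "map (count a) xs = d"
      and b: "set_mset b \<subseteq> set xs" "map (count b) xs = e"
      using ex_multiset_counts len xs(2) by metis
    have "map (count (a + b)) xs = map (count m) xs"
      using sum unfolding a(2)[symmetric] b(2)[symmetric] by (auto simp: in_set_conv_nth)
    then have "a + b = m" using a(1) b(1) xs(1) by (intro eqI) auto
    with y a b show "y \<in> (\<lambda>p. (map (count (fst p)) xs, map (count (snd p)) xs)) ` {p. fst p + snd p = m}"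
      by (intro image_eqI[of _ _ "(a, b)"]) auto
  qed
qed

lemma composition_shuffle:
  "w \<in># shuffle \<alpha> \<beta> \<Longrightarrow> composition \<alpha> \<Longrightarrow> composition \<beta> \<Longrightarrow> composition w"
  by (simp add: composition_def set_shuffle)

lemma desc_powersum_mult:
  assumes "composition \<alpha>" "composition \<beta>"
  shows "desc_powersum \<alpha> * desc_powersum \<beta> = (\<Sum>\<delta>\<in>#shuffle \<alpha> \<beta>. desc_powersum \<delta> :: 'k :: field_char_0 qsym)"
proof (rule qsym_eqI)
  fix m :: "nat multiset"
  let ?c = "desc_coeff :: nat list \<Rightarrow> nat list \<Rightarrow> 'k"
  define xs where "xs = sorted_list_of_set (set_mset m)"
  \<comment> \<open>Both factors are read over the variables of \<open>m\<close>; the zero exponents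
    that this introduces do not affect \<open>desc_coeff\<close>.\<close>
  have exps: "?c w (exponents a) = ?c w (map (count a) xs)"
    if "composition w" "a \<subseteq># m" for w and a :: "nat multiset"
  proof -
    have "exponents a = filter (\<lambda>n. n \<noteq> 0) (map (count a) xs)"
      unfolding xs_def using that by (intro exponents_eq_filter) (auto dest: mset_subset_eqD)
    then show ?thesis by (simp only: desc_coeff_filter_nonzero[OF that(1)])
  qed
  have "coeff_at (desc_powersum \<alpha> * desc_powersum \<beta>) m =
      (\<Sum>p | fst p + snd p = m. ?c \<alpha> (map (count (fst p)) xs) * ?c \<beta> (map (count (snd p)) xs))"
    unfolding times_qsym.rep_eq coeff_at_desc_powersum
    using assms by (intro sum.cong refl arg_cong2[where f = "(*)"] exps) auto
  also have "\<dots> = (\<Sum>(d, e)\<in>add_splits (map (count m) xs). ?c \<alpha> d * ?c \<beta> e)"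
    using sum.reindex_bij_betw[OF bij_betw_add_splits[of m], of "\<lambda>(d, e). ?c \<alpha> d * ?c \<beta> e"]
    by (simp add: xs_def)
  also have "\<dots> = (\<Sum>w\<in>#shuffle \<alpha> \<beta>. ?c w (map (count m) xs))"
    by (rule desc_coeff_shuffle[OF assms, symmetric])
  also have "\<dots> = (\<Sum>w\<in>#shuffle \<alpha> \<beta>. ?c w (exponents m))"
    using assms by (intro sum_mset_cong) (simp add: exps composition_shuffle)
  finally show "coeff_at (desc_powersum \<alpha> * desc_powersum \<beta>) m =
      coeff_at (\<Sum>\<delta>\<in>#shuffle \<alpha> \<beta>. desc_powersum \<delta> :: 'k qsym) m"
    by (simp add: coeff_at_sum_mset coeff_at_desc_powersum)
qed

section \<open>Coproduct formula\<close>

lemma sum_splits_map: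
  fixes h :: "'a list \<Rightarrow> 'a list \<Rightarrow> 'b :: comm_monoid_add"
  shows "(\<Sum>(u, v) | u @ v = map f w. h u v) = (\<Sum>(u, v) | u @ v = w. h (map f u) (map f v))"
  by (induction w arbitrary: h) (simp_all add: sum_splits_Nil sum_splits_Cons)

text \<open>Cutting a factorization between two blocks amounts to cutting the word and factorizing
  both pieces; concatenating the blocks on either side recovers the pieces.\<close>

lemma sum_splits_factorizations:
  fixes h :: "'a list list \<Rightarrow> 'a list list \<Rightarrow> 'b :: comm_monoid_add"
  shows "(\<Sum>Bs\<in>factorizations w. \<Sum>(Cs, Ds) | Cs @ Ds = Bs. h Cs Ds) =
    (\<Sum>(u, v) | u @ v = w. \<Sum>Cs\<in>factorizations u. \<Sum>Ds\<in>factorizations v. h Cs Ds)"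
proof -
  have "(\<Sum>Bs\<in>factorizations w. \<Sum>(Cs, Ds) | Cs @ Ds = Bs. h Cs Ds) =
      (\<Sum>(Bs, p)\<in>(SIGMA Bs:factorizations w. {(Cs, Ds). Cs @ Ds = Bs}). h (fst p) (snd p))"
    by (subst sum.Sigma) (auto simp: case_prod_unfold)
  also have "\<dots> = (\<Sum>(q, p)\<in>(SIGMA q:{(u, v). u @ v = w}. factorizations (fst q) \<times> factorizations (snd q)).
      h (fst p) (snd p))"
    by (rule sum.reindex_bij_witness[where
          j = "\<lambda>(Bs, p). ((concat (fst p), concat (snd p)), p)" and i = "\<lambda>(q, p). (fst p @ snd p, p)"])
       (auto simp: factorizations_def)
  also have "\<dots> = (\<Sum>(u, v) | u @ v = w. \<Sum>Cs\<in>factorizations u. \<Sum>Ds\<in>factorizations v. h Cs Ds)"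
    by (subst sum.Sigma[symmetric]) (auto simp: sum.cartesian_product case_prod_unfold)
  finally show ?thesis .
qed

lemma coproduct_zero [simp]: "\<Delta> 0 = 0"
  using coproduct_add[of 0 0] by simp

lemma coproduct_sum: "\<Delta> (\<Sum>i\<in>I. f i) = (\<Sum>i\<in>I. \<Delta> (f i))"
  by (induction I rule: infinite_finite_induct) (simp_all add: coproduct_add)

lemma tensor_zero [simp]: "0 \<otimes>\<^sub>Q g = 0" "f \<otimes>\<^sub>Q 0 = 0"
  using tensor_add_left[of 0 0 g] tensor_add_right[of f 0 0] by simp_all

lemma tensor_sum_left: "(\<Sum>i\<in>I. f i) \<otimes>\<^sub>Q g = (\<Sum>i\<in>I. f i \<otimes>\<^sub>Q g)"
  by (induction I rule: infinite_finite_induct) (simp_all add: tensor_add_left)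

lemma tensor_sum_right: "f \<otimes>\<^sub>Q (\<Sum>i\<in>I. g i) = (\<Sum>i\<in>I. f \<otimes>\<^sub>Q g i)"
  by (induction I rule: infinite_finite_induct) (simp_all add: tensor_add_right)

lemma composition_map_sum_list:
  assumes "composition w" "Bs \<in> factorizations w"
  shows "composition (map sum_list Bs)"
  unfolding composition_def set_map
proof
  assume "0 \<in> sum_list ` set Bs"
  then obtain B where B: "B \<in> set Bs" "sum_list B = 0" by auto
  with assms obtain b B' where "B = b # B'" by (cases B) (auto simp: factorizations_def)
  with B have "0 \<in> set (concat Bs)" unfolding set_concat by (intro UN_I[of B]) simp_all
  with assms show False by (simp add: factorizations_def composition_def)
qed

lemma coproduct_desc_powersum:
  assumes "composition \<gamma>"
  shows "\<Delta> (desc_powersum \<gamma> :: 'k :: field_char_0 qsym) =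
    (\<Sum>(\<delta>, \<epsilon>) | \<delta> @ \<epsilon> = \<gamma>. desc_powersum \<delta> \<otimes>\<^sub>Q desc_powersum \<epsilon>)"
proof -
  \<comment> \<open>Both sides reduce to this summand, because the weight of a concatenated list of
    blocks is the product of the two weights.\<close>
  let ?h = "\<lambda>Cs Ds. desc_weight_list (Cs @ Ds) *\<^sub>T
    (M (map sum_list Cs) \<otimes>\<^sub>Q M (map sum_list Ds)) :: 'k qsym_tensor"
  have tensor: "desc_powersum \<delta> \<otimes>\<^sub>Q desc_powersum \<epsilon> =
      (\<Sum>Cs\<in>factorizations \<delta>. \<Sum>Ds\<in>factorizations \<epsilon>. ?h Cs Ds)" for \<delta> \<epsilon>
    unfolding desc_powersum_def
    by (subst tensor_sum_left)
      (simp add: tensor_sum_right tensor_scale_left tensor_scale_right scale_tensor_scale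
        desc_weight_list_def mult.commute)
  have comp: "composition (map sum_list Bs)" if "Bs \<in> factorizations \<gamma>" for Bs
    using assms that by (rule composition_map_sum_list)
  have "\<Delta> (desc_powersum \<gamma> :: 'k qsym) = (\<Sum>Bs\<in>factorizations \<gamma>. \<Sum>(Cs, Ds) | Cs @ Ds = Bs. ?h Cs Ds)"
    unfolding desc_powersum_def coproduct_sum
  proof (intro sum.cong refl)
    fix Bs assume "Bs \<in> factorizations \<gamma>"
    then have "\<Delta> (desc_weight_list Bs *\<^sub>Q M (map sum_list Bs)) = desc_weight_list Bs *\<^sub>T
        (\<Sum>(Cs, Ds) | Cs @ Ds = Bs. M (map sum_list Cs) \<otimes>\<^sub>Q M (map sum_list Ds) :: 'k qsym_tensor)"
      \<comment> \<open>The coproduct cuts the list of block sums, and each such cut lifts to a cut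
        of the list of blocks.\<close>
      by (simp only: coproduct_scale coproduct_M[OF comp] sum_splits_map)
    also have "\<dots> = (\<Sum>(Cs, Ds) | Cs @ Ds = Bs. ?h Cs Ds)"
      unfolding scale_tensor_sum by (intro sum.cong) auto
    finally show "\<Delta> (desc_weight_list Bs *\<^sub>Q M (map sum_list Bs)) = (\<Sum>(Cs, Ds) | Cs @ Ds = Bs. ?h Cs Ds)" .
  qed
  also have "\<dots> = (\<Sum>(\<delta>, \<epsilon>) | \<delta> @ \<epsilon> = \<gamma>. \<Sum>Cs\<in>factorizations \<delta>. \<Sum>Ds\<in>factorizations \<epsilon>. ?h Cs Ds)"
    by (rule sum_splits_factorizations)
  also have "\<dots> = (\<Sum>(\<delta>, \<epsilon>) | \<delta> @ \<epsilon> = \<gamma>. desc_powersum \<delta> \<otimes>\<^sub>Q desc_powersum \<epsilon>)"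
    by (simp only: tensor)
  finally show ?thesis .
qed

section \<open>Counting row permutations\<close>

text \<open>The condition that \<open>row_perms\<close> imposes on each component, with
  \<open>c\<close> as the column of a row.\<close>

definition fibrewise_perms :: "nat set \<Rightarrow> (nat \<Rightarrow> 'c) \<Rightarrow> (nat \<Rightarrow> nat) set"
  where "fibrewise_perms A c =
    {\<sigma>. \<sigma> permutes A \<and> (\<forall>r\<in>A. \<forall>s\<in>A. c r = c s \<longrightarrow> r < s \<longrightarrow> \<sigma> r < \<sigma> s)}"

text \<open>Strong induction along \<open>A\<close>: if the two permutations agree below
  \<open>r\<close>, neither can have the smaller value at \<open>r\<close>.\<close>

lemma fibrewise_perms_eqI:
  assumes \<sigma>: "\<sigma> \<in> fibrewise_perms A c" and \<tau>: "\<tau> \<in> fibrewise_perms A c"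
    and eq: "\<And>s. s \<in> A \<Longrightarrow> c (inv_into UNIV \<sigma> s) = c (inv_into UNIV \<tau> s)"
  shows "\<sigma> = \<tau>"
proof
  have not_less_at: "\<not> \<rho> r < \<rho>' r"
    if \<rho>: "\<rho> \<in> fibrewise_perms A c" and \<rho>': "\<rho>' \<in> fibrewise_perms A c"
      and eq: "\<And>s. s \<in> A \<Longrightarrow> c (inv_into UNIV \<rho> s) = c (inv_into UNIV \<rho>' s)"
      and IH: "\<And>s. s \<in> A \<Longrightarrow> s < r \<Longrightarrow> \<rho> s = \<rho>' s" and r: "r \<in> A" for \<rho> \<rho>' r
  proof
    assume less: "\<rho> r < \<rho>' r"
    have p: "\<rho> permutes A" "\<rho>' permutes A"
      using \<rho> \<rho>' by (auto simp: fibrewise_perms_def)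
    \<comment> \<open>\<open>s\<close> is the element that \<open>\<rho>'\<close> sends to the
      smaller value \<open>\<rho> r\<close>. It has the label of \<open>r\<close>, so monotonicity
      of \<open>\<rho>'\<close> on fibres puts it before \<open>r\<close>, where both permutations
      agree; then \<open>\<rho>\<close> would not be injective.\<close>
    define s where "s = inv_into UNIV \<rho>' (\<rho> r)"
    have s: "\<rho>' s = \<rho> r" "s \<in> A"
      using p r by (simp_all add: s_def permutes_inverses permutes_in_image permutes_inv)
    have "c s = c r"
      using eq[of "\<rho> r"] p r by (simp add: s_def permutes_inverses permutes_in_image)
    then have "s < r"
      using \<rho>' s r less unfolding fibrewise_perms_def
      by (metis (mono_tags, lifting) mem_Collect_eq not_less_iff_gr_or_eq)
    then have "\<rho> s = \<rho> r" using IH s by auto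
    then have "s = r" using p(1) by (metis permutes_inverses(2))
    with \<open>s < r\<close> show False by simp
  qed
  fix r
  show "\<sigma> r = \<tau> r"
  proof (cases "r \<in> A")
    case True
    then show ?thesis
    proof (induction r rule: less_induct)
      case (less r)
      have "\<not> \<sigma> r < \<tau> r" by (rule not_less_at[OF \<sigma> \<tau>]) (use eq less in auto)
      moreover have "\<not> \<tau> r < \<sigma> r"
        by (rule not_less_at[OF \<tau> \<sigma>]) (use eq less in auto)
      ultimately show ?case by simp
    qed
  next
    case False
    then show ?thesis
      using \<sigma> \<tau> unfolding fibrewise_perms_def by (metis (no_types, lifting) mem_Collect_eq permutes_not_in)
  qed
qed

text \<open>Composes the rank function of \<open>A\<close> with the increasing enumeration of
  \<open>B\<close>.\<close>

lemma ex_bij_betw_strict_mono_on: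
  fixes A B :: "nat set"
  assumes "finite A" "finite B" "card A = card B"
  shows "\<exists>h. bij_betw h A B \<and> strict_mono_on A h"
proof -
  obtain f where f: "bij_betw f {..<card A} A" "strict_mono_on {..<card A} f"
    using ex_bij_betw_strict_mono_card[OF assms(1)] by blast
  obtain g where g: "bij_betw g {..<card A} B" "strict_mono_on {..<card A} g"
    using ex_bij_betw_strict_mono_card[OF assms(2)] assms(3) by metis
  define k where "k = inv_into {..<card A} f"
  have k: "bij_betw k A {..<card A}" using f(1) by (simp add: k_def bij_betw_inv_into)
  have fk: "f (k x) = x" if "x \<in> A" for x
    using f(1) that by (simp add: k_def bij_betw_inv_into_right)
  have "k x < k y" if "x \<in> A" "y \<in> A" "x < y" for x y
  proof (rule ccontr)
    assume "\<not> k x < k y"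
    then consider "k x = k y" | "k y < k x" by linarith
    then show False
    proof cases
      case 1
      then show False using fk that by (metis less_irrefl)
    next
      case 2
      moreover have "k x \<in> {..<card A}" "k y \<in> {..<card A}"
        using k that by (auto dest: bij_betwE)
      ultimately have "f (k y) < f (k x)" using f(2) by (auto simp: strict_mono_on_def)
      then show False using fk that by simp
    qed
  qed
  moreover have "k x \<in> {..<card A}" if "x \<in> A" for x using k that by (auto dest: bij_betwE)
  ultimately have "strict_mono_on A (g \<circ> k)"
    using g(2) by (auto simp: strict_mono_on_def)
  then show ?thesis using bij_betw_trans[OF k g(1)] by blast
qed

text \<open>Increasing bijections between corresponding fibres of \<open>c\<close> and
  \<open>w\<close> are glued together. The value of \<open>w\<close> at an image tells which fibre
  it came from, so the result is injective.\<close>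

lemma ex_fibrewise_perm:
  assumes fin: "finite A" and card: "\<And>x. card {r \<in> A. c r = x} = card {s \<in> A. w s = x}"
  shows "\<exists>\<sigma>\<in>fibrewise_perms A c. \<forall>s\<in>A. c (inv_into UNIV \<sigma> s) = w s"
proof -
  have "\<exists>h. \<forall>x. bij_betw (h x) {r \<in> A. c r = x} {s \<in> A. w s = x} \<and>
      strict_mono_on {r \<in> A. c r = x} (h x)"
    by (intro choice allI ex_bij_betw_strict_mono_on card) (use fin in auto)
  then obtain h where h: "\<And>x. bij_betw (h x) {r \<in> A. c r = x} {s \<in> A. w s = x}"
    and mono: "\<And>x. strict_mono_on {r \<in> A. c r = x} (h x)"
    by blast
  define \<sigma> where "\<sigma> r = (if r \<in> A then h (c r) r else r)" for r
  have \<sigma>: "\<sigma> r \<in> A" "w (\<sigma> r) = c r" if "r \<in> A" for r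
  proof -
    have "h (c r) r \<in> {s \<in> A. w s = c r}"
      by (rule bij_betw_apply[OF h]) (simp add: that)
    then show "\<sigma> r \<in> A" "w (\<sigma> r) = c r" by (simp_all add: \<sigma>_def that)
  qed
  have "inj_on \<sigma> A"
  proof (rule inj_onI)
    fix r s assume rs: "r \<in> A" "s \<in> A" "\<sigma> r = \<sigma> s"
    then have "c r = c s" using \<sigma> by metis
    with rs bij_betw_imp_inj_on[OF h[of "c s"]] show "r = s"
      by (auto simp: \<sigma>_def dest: inj_onD)
  qed
  moreover have "\<sigma> ` A \<subseteq> A" using \<sigma> by auto
  ultimately have "bij_betw \<sigma> A A"
    using fin by (simp add: bij_betw_def endo_inj_surj)
  then have perm: "\<sigma> permutes A" by (rule bij_imp_permutes) (simp add: \<sigma>_def)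
  moreover have "\<sigma> r < \<sigma> s" if "r \<in> A" "s \<in> A" "c r = c s" "r < s" for r s
    using mono[of "c s"] that by (auto simp: \<sigma>_def strict_mono_on_def)
  moreover have "c (inv_into UNIV \<sigma> s) = w s" if "s \<in> A" for s
  proof -
    have "inv_into UNIV \<sigma> s \<in> A" using perm that by (simp add: permutes_in_image permutes_inv)
    then show ?thesis using \<sigma>(2)[of "inv_into UNIV \<sigma> s"] perm by (simp add: permutes_inverses)
  qed
  ultimately show ?thesis by (auto simp: fibrewise_perms_def)
qed

text \<open>
  A fibrewise increasing permutation \<open>\<sigma>\<close> is determined by the word \<open>c \<circ> inv_into UNIV \<sigma>\<close>, and every
  rearrangement of \<open>c\<close> arises in this way.
\<close>

lemma card_fibrewise_perms:
  fixes A :: "nat set"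
  assumes fin: "finite A"
  shows "card (fibrewise_perms A c) * (\<Prod>x\<in>c ` A. fact (card {r \<in> A. c r = x})) = fact (card A)"
proof -
  define xs where "xs = sorted_list_of_set A"
  define N where "N = image_mset c (mset_set A)"
  have xs: "set xs = A" "distinct xs" "mset xs = mset_set A"
    using fin mset_set_set[of "sorted_list_of_set A"] by (simp_all add: xs_def)
  have count_N: "count (image_mset w (mset_set A)) x = card {r \<in> A. w r = x}" for w x
    using fin by (simp add: count_image_mset' eq_commute[of x])
  have perm: "\<sigma> permutes A" if "\<sigma> \<in> fibrewise_perms A c" for \<sigma>
    using that by (simp add: fibrewise_perms_def)
  have "bij_betw (\<lambda>\<sigma>. map (c \<circ> inv_into UNIV \<sigma>) xs) (fibrewise_perms A c) (permutations_of_multiset N)"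
    unfolding bij_betw_def
  proof (intro conjI equalityI subsetI)
    show "inj_on (\<lambda>\<sigma>. map (c \<circ> inv_into UNIV \<sigma>) xs) (fibrewise_perms A c)"
      by (rule inj_onI, rule fibrewise_perms_eqI[of _ A c]) (use xs in auto)
  next
    fix ys assume "ys \<in> (\<lambda>\<sigma>. map (c \<circ> inv_into UNIV \<sigma>) xs) ` fibrewise_perms A c"
    then obtain \<sigma> where \<sigma>: "\<sigma> \<in> fibrewise_perms A c" "ys = map (c \<circ> inv_into UNIV \<sigma>) xs" by blast
    have "mset ys = image_mset c (image_mset (inv_into UNIV \<sigma>) (mset_set A))"
      using \<sigma>(2) xs(3) by (simp add: multiset.map_comp comp_def)
    also have "image_mset (inv_into UNIV \<sigma>) (mset_set A) = mset_set A"
      using permutes_inv[OF perm[OF \<sigma>(1)]] by (rule permutes_image_mset)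
    finally show "ys \<in> permutations_of_multiset N" by (simp add: permutations_of_multiset_def N_def)
  next
    fix ys assume "ys \<in> permutations_of_multiset N"
    then have ys: "mset ys = N" by (simp add: permutations_of_multiset_def)
    then have len: "length ys = length xs"
      by (metis N_def size_image_mset size_mset xs(3))
    define w where "w = the \<circ> map_of (zip xs ys)"
    have w: "map w xs = ys"
      using len xs(2) by (auto intro!: nth_equalityI simp: w_def map_of_zip_nth)
    then have "image_mset w (mset_set A) = image_mset c (mset_set A)"
      using ys by (metis N_def mset_map xs(3))
    then have "card {r \<in> A. c r = x} = card {s \<in> A. w s = x}" for x
      by (metis count_N)
    then obtain \<sigma> where "\<sigma> \<in> fibrewise_perms A c" "\<forall>s\<in>A. c (inv_into UNIV \<sigma> s) = w s"
      using ex_fibrewise_perm[OF fin] by blast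
    then show "ys \<in> (\<lambda>\<sigma>. map (c \<circ> inv_into UNIV \<sigma>) xs) ` fibrewise_perms A c"
      using w xs(1) by (intro image_eqI[of _ _ \<sigma>]) auto
  qed
  then have "card (fibrewise_perms A c) = card (permutations_of_multiset N)"
    by (rule bij_betw_same_card)
  \<comment> \<open>The multinomial coefficient that counts the words, written without
    division.\<close>
  moreover have "card (permutations_of_multiset N) * (\<Prod>x\<in>set_mset N. fact (count N x)) = fact (size N)"
    using card_permutations_of_multiset[of N] by simp
  ultimately show ?thesis using fin by (simp add: N_def count_N)
qed

section \<open>Families of row permutations\<close>

lemma finite_fibrewise_perms: "finite A \<Longrightarrow> finite (fibrewise_perms A c)"
  by (rule finite_subset[OF _ finite_permutations[of A]]) (auto simp: fibrewise_perms_def)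

text \<open>Families indexed by all natural numbers reduce to a finite product, as outside
  \<open>V\<close> there is only the default choice \<open>d\<close>.\<close>

lemma card_dependent_functions:
  assumes "finite V" "\<And>i. i \<in> V \<Longrightarrow> finite (S i)" "\<And>i. i \<notin> V \<Longrightarrow> S i = {d}"
  shows "finite {f. \<forall>i. f i \<in> S i}" "card {f. \<forall>i. f i \<in> S i} = (\<Prod>i\<in>V. card (S i))"
proof -
  have "bij_betw (\<lambda>f. restrict f V) {f. \<forall>i. f i \<in> S i} (PiE V S)"
    using assms(3)
    by (intro bij_betwI[where g = "\<lambda>f i. if i \<in> V then f i else d"])
       (auto simp: fun_eq_iff restrict_def PiE_def extensional_def Pi_def split: if_splits,
        metis singletonD)
  then show "finite {f. \<forall>i. f i \<in> S i}" "card {f. \<forall>i. f i \<in> S i} = (\<Prod>i\<in>V. card (S i))"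
    using assms by (simp_all add: bij_betw_finite[of _ _ "PiE V S"] bij_betw_same_card finite_PiE card_PiE)
qed

lemma row_perms_eq: "row_perms F = {\<sigma>. \<forall>i. \<sigma> i \<in> fibrewise_perms (rows_with F i) (col_of F)}"
  by (simp add: row_perms_def fibrewise_perms_def)

text \<open>The components preserve entries, so the image of a row reveals which component moved it,
  and injectivity follows from that of the single components.\<close>

lemma row_move_permutes:
  assumes "\<sigma> \<in> row_perms F"
  shows "row_move F \<sigma> permutes {..<dim_row F}"
proof (rule bij_imp_permutes)
  have perm: "\<sigma> i permutes rows_with F i" for i using assms by (simp add: row_perms_def)
  have move: "row_move F \<sigma> r \<in> rows_with F (entry F r)" if "r < dim_row F" for r
    using that permutes_in_image[OF perm[of "entry F r"], of r] by (simp add: row_move_def rows_with_def)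
  then have "row_move F \<sigma> ` {..<dim_row F} \<subseteq> {..<dim_row F}" by (auto simp: rows_with_def)
  moreover have "inj_on (row_move F \<sigma>) {..<dim_row F}"
  proof (rule inj_onI)
    fix r s assume rs: "r \<in> {..<dim_row F}" "s \<in> {..<dim_row F}" "row_move F \<sigma> r = row_move F \<sigma> s"
    then have "entry F r = entry F s" using move[of r] move[of s] by (simp add: rows_with_def)
    with rs show "r = s" using permutes_inj[OF perm] by (auto simp: row_move_def dest: injD)
  qed
  ultimately show "bij_betw (row_move F \<sigma>) {..<dim_row F} {..<dim_row F}"
    by (simp add: bij_betw_def endo_inj_surj)
qed (simp add: row_move_def)

lemma col_sums_act:
  assumes "\<sigma> \<in> row_perms F"
  shows "col_sums (act \<sigma> F) = col_sums F"
proof -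
  let ?\<pi> = "inv_into UNIV (row_move F \<sigma>)"
  have \<pi>: "?\<pi> permutes {..<dim_row F}" using row_move_permutes[OF assms] by (rule permutes_inv)
  have "(\<Sum>r<dim_row F. act \<sigma> F $$ (r, c)) = (\<Sum>r<dim_row F. F $$ (r, c))" if "c < dim_col F" for c
  proof -
    have "(\<Sum>r<dim_row F. act \<sigma> F $$ (r, c)) = (\<Sum>r<dim_row F. F $$ (?\<pi> r, c))"
      using that by (intro sum.cong) (auto simp: act_def)
    also have "\<dots> = (\<Sum>r<dim_row F. F $$ (r, c))"
      using sum.permute[OF \<pi>, of "\<lambda>r. F $$ (r, c)"] by (simp add: comp_def)
    finally show ?thesis .
  qed
  moreover have "dim_row (act \<sigma> F) = dim_row F" "dim_col (act \<sigma> F) = dim_col F"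
    by (simp_all add: act_def)
  ultimately show ?thesis unfolding col_sums_def by (intro arg_cong[of _ _ "filter _"] map_cong) auto
qed

section \<open>Strict diagonal fillings as factorizations\<close>

text \<open>Columns of the rows in the filling that belongs to a factorization; the offset
  \<open>k\<close> serves inductions.\<close>

fun block_labels :: "nat \<Rightarrow> 'a list list \<Rightarrow> nat list"
  where
    "block_labels k [] = []"
  | "block_labels k (B # Bs) = replicate (length B) k @ block_labels (Suc k) Bs"

lemma length_block_labels [simp]: "length (block_labels k Bs) = length (concat Bs)"
  by (induction Bs arbitrary: k) simp_all

lemma set_block_labels_subset: "set (block_labels k Bs) \<subseteq> {k..<k + length Bs}"
proof (induction Bs arbitrary: k)
  case (Cons B Bs)
  show ?case using Cons[of "Suc k"] by auto
qed simp

lemma set_block_labels: "[] \<notin> set Bs \<Longrightarrow> set (block_labels k Bs) = {k..<k + length Bs}"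
proof (induction Bs arbitrary: k)
  case (Cons B Bs)
  then have "set (block_labels (Suc k) Bs) = {Suc k..<Suc k + length Bs}" "B \<noteq> []" by auto
  moreover have "{k..<k + length (B # Bs)} = insert k {Suc k..<Suc k + length Bs}" by auto
  ultimately show ?case by (simp add: set_replicate_conv_if)
qed simp

text \<open>Labels of later blocks exceed those of earlier ones, so a block can be recovered from
  its label. Column sums, multiplicities and the injectivity of \<open>block_mat\<close> rest on
  this.\<close>

lemma filter_block_labels:
  assumes "c < length Bs"
  shows "map snd (filter (\<lambda>p. fst p = k + c) (zip (block_labels k Bs) (concat Bs))) = Bs ! c"
  using assms
proof (induction Bs arbitrary: k c)
  case (Cons B Bs)
  have B: "filter (\<lambda>p. fst p = j) (zip (replicate (length B) k) B) =
      (if j = k then zip (replicate (length B) k) B else [])" for j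
    by (auto simp: filter_empty_conv filter_id_conv set_zip)
  show ?case
  proof (cases c)
    case 0
    have "fst p \<noteq> k" if "p \<in> set (zip (block_labels (Suc k) Bs) (concat Bs))" for p
    proof -
      have "fst p \<in> set (block_labels (Suc k) Bs)" using that by (metis prod.collapse set_zip_leftD)
      then show ?thesis using set_block_labels_subset[of "Suc k" Bs] by force
    qed
    then show ?thesis using 0 B by (auto simp: filter_empty_conv)
  next
    case (Suc c')
    then show ?thesis using Cons.IH[of c' "Suc k"] Cons.prems B by simp
  qed
qed simp

lemma sum_block:
  assumes "c < length Bs"
  shows "(\<Sum>r<length (concat Bs). if block_labels 0 Bs ! r = c then concat Bs ! r else 0) =
    sum_list (Bs ! c)"
  unfolding filter_block_labels[OF assms, of 0, symmetric] sum_list_map_filter'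
  by (auto simp: sum_list_sum_nth atLeast0LessThan intro!: sum.cong)

lemma card_block:
  assumes "c < length Bs"
  shows "card {r. r < length (concat Bs) \<and> concat Bs ! r = i \<and> block_labels 0 Bs ! r = c} =
    count_list (Bs ! c) i"
  unfolding filter_block_labels[OF assms, of 0, symmetric] count_list_eq_length_filter filter_map
  by (auto simp: length_filter_conv_card comp_def intro!: arg_cong[of _ _ card])

text \<open>The step condition of \<open>SD\<close>, detached from the matrix.\<close>

definition label_steps :: "nat list \<Rightarrow> nat list \<Rightarrow> bool"
  where "label_steps \<alpha> l \<longleftrightarrow> (\<forall>i. Suc i < length \<alpha> \<longrightarrow>
    (if \<alpha> ! i \<ge> \<alpha> ! Suc i then l ! Suc i = l ! i \<or> l ! Suc i = Suc (l ! i) else l ! Suc i = Suc (l ! i)))"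

lemma label_steps_trivial [simp]: "label_steps [] l" "label_steps [a] l"
  by (simp_all add: label_steps_def)

lemma label_steps_Cons:
  "label_steps (a # b # \<alpha>) (x # y # l) \<longleftrightarrow>
    (y = Suc x \<or> a \<ge> b \<and> y = x) \<and> label_steps (b # \<alpha>) (y # l)"
  unfolding label_steps_def
  by (simp add: All_less_Suc2) auto

definition desc_factorizations :: "nat list \<Rightarrow> nat list list set"
  where "desc_factorizations \<alpha> = {Bs \<in> factorizations \<alpha>. \<forall>B\<in>set Bs. sorted_wrt (\<ge>) B}"

text \<open>The label is constant inside a block, which is allowed because the block is weakly
  decreasing, and rises at the next block, which is always allowed. As blocks are nonempty, it never
  rises by more than one.\<close>

lemma label_steps_block_labels:
  "Bs \<in> desc_factorizations \<alpha> \<Longrightarrow> label_steps \<alpha> (block_labels k Bs)"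
proof (induction \<alpha> arbitrary: Bs k)
  case (Cons a \<alpha>)
  then obtain B Bs' where Bs: "Bs = (a # B) # Bs'" "\<alpha> = B @ concat Bs'"
    by (cases Bs; cases "hd Bs") (auto simp: desc_factorizations_def factorizations_def)
  show ?case
  proof (cases B)
    case Nil
    then have "Bs' \<in> desc_factorizations \<alpha>"
      using Cons.prems Bs by (auto simp: desc_factorizations_def factorizations_def)
    note step = Cons.IH[OF this, of "Suc k"]
    show ?thesis
    proof (cases Bs')
      case (Cons C Cs)
      then obtain b C' where "C = b # C'"
        using Cons.prems Bs by (cases C) (auto simp: desc_factorizations_def factorizations_def)
      then show ?thesis using Bs Nil Cons step by (simp add: label_steps_Cons)
    qed (use Bs Nil in simp)
  next
    case (Cons b B')
    then have "B # Bs' \<in> desc_factorizations \<alpha>" "b \<le> a"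
      using Cons.prems Bs by (auto simp: desc_factorizations_def factorizations_def)
    with Cons.IH[OF this(1), of k] Bs Cons show ?thesis by (simp add: label_steps_Cons)
  qed
qed simp

text \<open>The word is cut where the label rises. A repeated label occurs only at a weak descent,
  so the blocks are weakly decreasing.\<close>

lemma ex_block_labels:
  assumes "label_steps \<alpha> l" "length l = length \<alpha>" "\<alpha> \<noteq> [] \<Longrightarrow> hd l = k"
  shows "\<exists>Bs\<in>desc_factorizations \<alpha>. block_labels k Bs = l"
  using assms
proof (induction \<alpha> arbitrary: l k)
  case Nil
  then show ?case by (intro bexI[of _ "[]"]) (simp_all add: desc_factorizations_def factorizations_def)
next
  case (Cons a \<alpha>)
  then obtain l' where l: "l = k # l'" "length l' = length \<alpha>" by (cases l) auto
  show ?case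
  proof (cases \<alpha>)
    case Nil
    then show ?thesis
      using l by (intro bexI[of _ "[[a]]"]) (simp_all add: desc_factorizations_def factorizations_def)
  next
    case (Cons b \<beta>)
    with l obtain y l'' where y: "l' = y # l''" by (cases l') auto
    with Cons.prems(1) l Cons have step: "y = Suc k \<or> a \<ge> b \<and> y = k" "label_steps \<alpha> l'"
      by (simp_all add: label_steps_Cons)
    obtain Bs where Bs: "Bs \<in> desc_factorizations \<alpha>" "block_labels y Bs = l'"
      using Cons.IH[OF step(2) l(2), of y] y by auto
    show ?thesis
    proof (cases "y = Suc k")
      case True
      then show ?thesis
        using Bs l by (intro bexI[of _ "[a] # Bs"]) (auto simp: desc_factorizations_def factorizations_def)
    next
      case False
      with step have "b \<le> a" "y = k" by auto
      obtain B Bs' where "Bs = (b # B) # Bs'"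
        using Bs(1) Cons by (cases Bs; cases "hd Bs") (auto simp: desc_factorizations_def factorizations_def)
      then show ?thesis
        using Bs l \<open>b \<le> a\<close> \<open>y = k\<close>
        by (intro bexI[of _ "(a # b # B) # Bs'"])
           (auto simp: desc_factorizations_def factorizations_def intro: order_trans)
    qed
  qed
qed

text \<open>The filling whose columns carry the blocks. Its width is the number of blocks, in
  accordance with the ban on zero columns in \<open>SD\<close>.\<close>

definition block_mat :: "nat list list \<Rightarrow> nat mat"
  where "block_mat Bs = mat (length (concat Bs)) (length Bs)
    (\<lambda>(r, c). if block_labels 0 Bs ! r = c then concat Bs ! r else 0)"

lemma dim_block_mat [simp]:
  "dim_row (block_mat Bs) = length (concat Bs)" "dim_col (block_mat Bs) = length Bs"
  by (simp_all add: block_mat_def)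

lemma block_mat_index:
  assumes "r < length (concat Bs)" "c < length Bs"
  shows "block_mat Bs $$ (r, c) = (if block_labels 0 Bs ! r = c then concat Bs ! r else 0)"
  using assms by (simp add: block_mat_def)

lemma block_labels_less: "r < length (concat Bs) \<Longrightarrow> block_labels 0 Bs ! r < length Bs"
  using subsetD[OF set_block_labels_subset nth_mem, of r 0 Bs] by simp

context
  fixes \<alpha> Bs
  assumes \<alpha>: "composition \<alpha>" and Bs: "Bs \<in> desc_factorizations \<alpha>"
begin

lemma concat_desc_factorization: "concat Bs = \<alpha>"
  using Bs by (simp add: desc_factorizations_def factorizations_def)

lemma block_mat_pos_iff:
  assumes "r < length \<alpha>" "c < length Bs"
  shows "0 < block_mat Bs $$ (r, c) \<longleftrightarrow> c = block_labels 0 Bs ! r"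
proof -
  have "\<alpha> ! r \<noteq> 0" using \<alpha> assms(1) by (metis composition_def nth_mem)
  then show ?thesis using assms by (simp add: block_mat_index concat_desc_factorization)
qed

lemma block_label_less: "r < length \<alpha> \<Longrightarrow> block_labels 0 Bs ! r < length Bs"
  using block_labels_less[of r Bs] by (simp add: concat_desc_factorization)

lemma col_of_block_mat: "r < length \<alpha> \<Longrightarrow> col_of (block_mat Bs) r = block_labels 0 Bs ! r"
  unfolding col_of_def by (rule the_equality) (auto simp: block_mat_pos_iff block_label_less)

lemma entry_block_mat: "r < length \<alpha> \<Longrightarrow> entry (block_mat Bs) r = \<alpha> ! r"
  by (simp add: entry_def col_of_block_mat block_mat_index block_label_less concat_desc_factorization)

lemma filling_block_mat: "filling (block_mat Bs)"
  unfolding filling_def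
proof (intro allI impI)
  fix r assume "r < dim_row (block_mat Bs)"
  then have r: "r < length \<alpha>" by (simp add: concat_desc_factorization)
  show "\<exists>!c. c < dim_col (block_mat Bs) \<and> block_mat Bs $$ (r, c) \<noteq> 0"
    by (rule ex1I[of _ "block_labels 0 Bs ! r"]) (use r in \<open>auto simp: block_mat_pos_iff block_label_less\<close>)
qed

lemma row_sums_block_mat: "row_sums (block_mat Bs) = \<alpha>"
proof -
  have "(\<Sum>c<length Bs. block_mat Bs $$ (r, c)) = \<alpha> ! r" if "r < length \<alpha>" for r
  proof -
    have "(\<Sum>c<length Bs. block_mat Bs $$ (r, c)) =
        (\<Sum>c<length Bs. if c = block_labels 0 Bs ! r then \<alpha> ! r else 0)"
      using that by (intro sum.cong) (auto simp: block_mat_index concat_desc_factorization)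
    then show ?thesis using block_label_less[OF that] by simp
  qed
  then show ?thesis by (auto simp: row_sums_def concat_desc_factorization intro!: nth_equalityI)
qed

lemma col_sums_block_mat: "col_sums (block_mat Bs) = map sum_list Bs"
proof -
  have "(\<Sum>r<length (concat Bs). block_mat Bs $$ (r, c)) = sum_list (Bs ! c)" if "c < length Bs" for c
    unfolding sum_block[OF that, symmetric] using that by (intro sum.cong) (auto simp: block_mat_index)
  then have "map (\<lambda>c. \<Sum>r<dim_row (block_mat Bs). block_mat Bs $$ (r, c)) [0..<dim_col (block_mat Bs)] =
      map sum_list Bs"
    by (auto intro!: nth_equalityI)
  moreover have "composition (map sum_list Bs)"
    using Bs \<alpha> by (intro composition_map_sum_list) (auto simp: desc_factorizations_def)
  ultimately show ?thesis
    unfolding col_sums_def by (auto simp: composition_def filter_id_conv)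
qed

lemma block_mat_in_SD: "block_mat Bs \<in> SD \<alpha>"
proof -
  have ne: "[] \<notin> set Bs" using Bs by (simp add: desc_factorizations_def factorizations_def)
  have "col_of (block_mat Bs) 0 = 0" if "\<alpha> \<noteq> []"
  proof -
    have "block_labels 0 Bs ! 0 = 0"
      using ne that concat_desc_factorization by (cases Bs; cases "hd Bs") auto
    then show ?thesis using that by (simp add: col_of_block_mat)
  qed
  moreover have "\<exists>r<length \<alpha>. block_mat Bs $$ (r, c) \<noteq> 0" if "c < length Bs" for c
  proof -
    \<comment> \<open>Nonempty blocks use every label, so no column is zero.\<close>
    have "c \<in> set (block_labels 0 Bs)" using ne that by (simp add: set_block_labels)
    then obtain r where "r < length \<alpha>" "block_labels 0 Bs ! r = c"
      by (auto simp: in_set_conv_nth concat_desc_factorization)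
    with that show ?thesis by (auto simp: block_mat_pos_iff)
  qed
  ultimately show ?thesis
    using filling_block_mat row_sums_block_mat label_steps_block_labels[OF Bs, of 0]
    by (simp add: SD_def concat_desc_factorization col_of_block_mat label_steps_def)
qed

text \<open>For each \<open>i\<close> the number of components is a multinomial coefficient: the
  factorial of the multiplicity of \<open>i\<close> in \<open>\<alpha>\<close>, divided by those of
  its multiplicities in the blocks. The powers of \<open>i\<close> distribute over the blocks and
  complete the denominators to the numbers \<open>z_comp B\<close>.\<close>

lemma card_row_perms_block_mat:
  "z_comp \<alpha> = card (row_perms (block_mat Bs)) * prod_list (map z_comp Bs)"
  "finite (row_perms (block_mat Bs))"
proof -
  let ?F = "block_mat Bs"
  let ?S = "\<lambda>i. fibrewise_perms (rows_with ?F i) (col_of ?F)"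
  let ?V = "set \<alpha>"
  have rows: "rows_with ?F i = {r. r < length \<alpha> \<and> \<alpha> ! r = i}" for i
    by (auto simp: rows_with_def entry_block_mat concat_desc_factorization)
  have fin: "finite (rows_with ?F i)" for i
    by (simp add: rows)
  have card_rows: "card (rows_with ?F i) = count_list \<alpha> i" for i
    by (simp add: rows count_list_eq_length_filter length_filter_conv_card eq_commute[of i])
  have triv: "?S i = {id}" if "i \<notin> ?V" for i
  proof -
    have "rows_with ?F i = {}" using that by (auto simp: rows)
    then show ?thesis by (auto simp: fibrewise_perms_def)
  qed
  note dep = card_dependent_functions[of ?V ?S id, OF _ finite_fibrewise_perms[OF fin] triv]
  show "finite (row_perms ?F)" unfolding row_perms_eq by (rule dep(1)) simp_all
  have card: "card (row_perms ?F) = (\<Prod>i\<in>?V. card (?S i))"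
    unfolding row_perms_eq by (rule dep(2)) simp_all
  have S: "card (?S i) * (\<Prod>B\<leftarrow>Bs. fact (count_list B i)) = fact (count_list \<alpha> i)" for i
  proof -
    let ?m = "\<lambda>c. card {r \<in> rows_with ?F i. col_of ?F r = c}"
    have m: "?m c = count_list (Bs ! c) i" if "c < length Bs" for c
      unfolding card_block[OF that, symmetric] concat_desc_factorization
      by (intro arg_cong[of _ _ card]) (auto simp: rows col_of_block_mat)
    have "col_of ?F ` rows_with ?F i \<subseteq> {..<length Bs}"
      by (auto simp: rows col_of_block_mat block_label_less)
    \<comment> \<open>Columns without the entry \<open>i\<close> contribute
      \<open>fact 0 = 1\<close>, so the product may run over all columns.\<close>
    then have "(\<Prod>c\<in>col_of ?F ` rows_with ?F i. fact (?m c)) = (\<Prod>c<length Bs. fact (?m c) :: nat)"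
    proof (rule prod.mono_neutral_left[rotated], intro ballI)
      fix c assume "c \<in> {..<length Bs} - col_of ?F ` rows_with ?F i"
      then have "{r \<in> rows_with ?F i. col_of ?F r = c} = {}" by auto
      then show "fact (?m c) = (1 :: nat)" by (simp only: card.empty fact_0)
    qed simp
    also have "\<dots> = (\<Prod>B\<leftarrow>Bs. fact (count_list B i))"
      by (simp add: m prod.list_conv_set_nth atLeast0LessThan)
    finally show ?thesis using card_fibrewise_perms[OF fin, of i "col_of ?F"] by (simp add: card_rows)
  qed
  have blocks: "prod_list (map z_comp Cs) =
      (\<Prod>i\<in>?V. i ^ count_list (concat Cs) i * (\<Prod>B\<leftarrow>Cs. fact (count_list B i)))"
    if "set (concat Cs) \<subseteq> ?V" for Cs
    using that
  proof (induction Cs)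
    case (Cons C Cs)
    then show ?case
      by (simp add: z_comp_superset[of ?V C] prod.distrib[symmetric] power_add mult_ac)
  qed simp
  have "card (row_perms ?F) * prod_list (map z_comp Bs) =
      (\<Prod>i\<in>?V. i ^ count_list \<alpha> i * (card (?S i) * (\<Prod>B\<leftarrow>Bs. fact (count_list B i))))"
    by (simp add: card blocks concat_desc_factorization prod.distrib[symmetric] mult_ac)
  also have "\<dots> = z_comp \<alpha>" by (simp add: S z_comp_def)
  finally show "z_comp \<alpha> = card (row_perms ?F) * prod_list (map z_comp Bs)" ..
qed

end

text \<open>The columns of the rows satisfy \<open>label_steps\<close>, hence are the labels of a
  factorization. Since no column is zero, these labels fill the whole width, so the dimensions
  agree.\<close>

lemma SD_eq_block_mat:
  assumes \<alpha>: "composition \<alpha>" and F: "F \<in> SD \<alpha>"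
  shows "\<exists>Bs\<in>desc_factorizations \<alpha>. F = block_mat Bs"
proof -
  define n where "n = dim_row F"
  define l where "l = map (col_of F) [0..<n]"
  have fill: "filling F" and rows: "row_sums F = \<alpha>"
    and cols: "\<And>c. c < dim_col F \<Longrightarrow> \<exists>r<n. F $$ (r, c) \<noteq> 0"
    using F by (auto simp: SD_def n_def)
  have n: "n = length \<alpha>" using rows by (auto simp: row_sums_def n_def)
  have col: "col_of F r < dim_col F" "F $$ (r, c) \<noteq> 0 \<longleftrightarrow> c = col_of F r"
    if "r < n" "c < dim_col F" for r c
  proof -
    have ex1: "\<exists>!c. c < dim_col F \<and> F $$ (r, c) \<noteq> 0" using fill that by (simp add: filling_def n_def)
    from theI'[OF ex1] show "col_of F r < dim_col F" by (simp add: col_of_def)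
    from theI'[OF ex1] ex1 that show "F $$ (r, c) \<noteq> 0 \<longleftrightarrow> c = col_of F r"
      unfolding col_of_def by blast
  qed
  have col_less: "col_of F r < dim_col F" if "r < n" for r
  proof -
    have "\<exists>!c. c < dim_col F \<and> F $$ (r, c) \<noteq> 0" using fill that by (simp add: filling_def n_def)
    then show ?thesis using col(1)[OF that] by blast
  qed
  have entry: "F $$ (r, c) = (if l ! r = c then \<alpha> ! r else 0)" if "r < n" "c < dim_col F" for r c
  proof -
    have "\<alpha> ! r = (\<Sum>c<dim_col F. F $$ (r, c))"
      using that(1) unfolding rows[symmetric] by (simp add: row_sums_def n_def)
    also have "\<dots> = (\<Sum>c\<in>{col_of F r}. F $$ (r, c))"
      using col_less[OF that(1)] col(2)[OF that(1)] by (intro sum.mono_neutral_right) auto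
    finally have "F $$ (r, col_of F r) = \<alpha> ! r" by simp
    with col(2)[OF that] that show ?thesis by (auto simp: l_def)
  qed
  have "label_steps \<alpha> l"
    using F n by (simp add: SD_def label_steps_def l_def)
  moreover have "length l = length \<alpha>" "\<alpha> \<noteq> [] \<Longrightarrow> hd l = 0"
    using F n by (simp_all add: l_def SD_def hd_map hd_upt)
  ultimately obtain Bs where Bs: "Bs \<in> desc_factorizations \<alpha>" "block_labels 0 Bs = l"
    using ex_block_labels by blast
  have conc: "concat Bs = \<alpha>" "[] \<notin> set Bs"
    using Bs(1) by (auto simp: desc_factorizations_def factorizations_def)
  have "{..<length Bs} = set l" using set_block_labels[OF conc(2), of 0] by (simp add: Bs(2) atLeast0LessThan)
  also have "set l = {..<dim_col F}"
  proof (intro equalityI subsetI)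
    fix c assume "c \<in> {..<dim_col F}"
    then obtain r where "r < n" "F $$ (r, c) \<noteq> 0" using cols by blast
    with \<open>c \<in> _\<close> col(2)[of r c] show "c \<in> set l" by (simp add: l_def)
  qed (use col_less in \<open>auto simp: l_def\<close>)
  finally have "length Bs = dim_col F" by (metis card_lessThan)
  then have "F = block_mat Bs"
    using conc n entry by (intro eq_matI) (simp_all add: block_mat_index Bs(2), simp_all add: n_def)
  with Bs(1) show ?thesis by blast
qed

text \<open>For injectivity, the matrix determines the labels through \<open>col_of\<close>, and the
  labels cut \<open>\<alpha>\<close> into its blocks.\<close>

lemma bij_betw_block_mat:
  assumes "composition \<alpha>"
  shows "bij_betw block_mat (desc_factorizations \<alpha>) (SD \<alpha>)"
  unfolding bij_betw_def
proof (intro conjI equalityI subsetI inj_onI)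
  fix Bs Cs assume BC: "Bs \<in> desc_factorizations \<alpha>" "Cs \<in> desc_factorizations \<alpha>"
    "block_mat Bs = block_mat Cs"
  have len: "length Bs = length Cs" using arg_cong[OF BC(3), of dim_col] by simp
  have conc: "concat Bs = \<alpha>" "concat Cs = \<alpha>"
    using BC by (simp_all add: desc_factorizations_def factorizations_def)
  have lab: "block_labels 0 Bs = block_labels 0 Cs"
    by (rule nth_equalityI)
       (use conc BC col_of_block_mat[OF assms] in \<open>auto, metis\<close>)
  show "Bs = Cs"
  proof (rule nth_equalityI[OF len])
    fix c assume "c < length Bs"
    then show "Bs ! c = Cs ! c"
      using filter_block_labels[of c Bs 0] filter_block_labels[of c Cs 0] len lab conc by simp
  qed
qed (use block_mat_in_SD[OF assms] SD_eq_block_mat[OF assms] in blast)+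

section \<open>From fillings to the closed form of \<open>P_scaled\<close>, and the two
  formulas\<close>

lemma P_scaled_eq_desc_powersum:
  assumes \<alpha>: "composition \<alpha>"
  shows "P_scaled \<alpha> = (desc_powersum \<alpha> :: 'k :: field_char_0 qsym)"
proof -
  let ?D = "desc_factorizations \<alpha>"
  have finD: "finite ?D" by (simp add: desc_factorizations_def)
  have scale_add: "c *\<^sub>Q (f + g) = c *\<^sub>Q f + c *\<^sub>Q g" for c and f g :: "'k qsym"
    by (rule qsym_eqI) (simp add: scale_qsym.rep_eq plus_qsym.rep_eq distrib_left)
  have scale_zero: "c *\<^sub>Q 0 = (0 :: 'k qsym)" "0 *\<^sub>Q f = 0" for c and f :: "'k qsym"
    by (rule qsym_eqI, simp add: scale_qsym.rep_eq zero_qsym.rep_eq)+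
  have scale_sum: "c *\<^sub>Q (\<Sum>i\<in>I. f i) = (\<Sum>i\<in>I. c *\<^sub>Q f i)" for c I and f :: "nat list list \<Rightarrow> 'k qsym"
    by (induction I rule: infinite_finite_induct) (simp_all add: scale_add scale_zero)
  have scale_sum_const: "c *\<^sub>Q (\<Sum>i\<in>I. f) = (c * of_nat (card I)) *\<^sub>Q f"
    for c and I :: "(nat \<Rightarrow> nat \<Rightarrow> nat) set" and f :: "'k qsym"
    by (rule qsym_eqI) (simp only: scale_qsym.rep_eq coeff_at_sum, simp)
  have "P \<alpha> = (\<Sum>F\<in>SD \<alpha>. \<Sum>\<sigma>\<in>row_perms F. M (col_sums (act \<sigma> F)) :: 'k qsym)"
  proof -
    have "finite (SD \<alpha>)" using finD bij_betw_finite[OF bij_betw_block_mat[OF \<alpha>]] by simp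
    moreover have "finite (row_perms F)" if "F \<in> SD \<alpha>" for F
      using SD_eq_block_mat[OF \<alpha> that] card_row_perms_block_mat(2)[OF \<alpha>] by auto
    ultimately show ?thesis unfolding P_def by (subst sum.Sigma) auto
  qed
  also have "\<dots> = (\<Sum>Bs\<in>?D. \<Sum>\<sigma>\<in>row_perms (block_mat Bs). M (col_sums (act \<sigma> (block_mat Bs))))"
    by (rule sum.reindex_bij_betw[OF bij_betw_block_mat[OF \<alpha>], symmetric])
  \<comment> \<open>Row permutations leave the column sums unchanged, so the inner sum becomes a
    count.\<close>
  also have "\<dots> = (\<Sum>Bs\<in>?D. \<Sum>\<sigma>\<in>row_perms (block_mat Bs). M (map sum_list Bs))"
    by (intro sum.cong refl) (simp add: col_sums_act col_sums_block_mat[OF \<alpha>])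
  finally have "P_scaled \<alpha> = (\<Sum>Bs\<in>?D. (1 / of_nat (z_comp \<alpha>) * of_nat (card (row_perms (block_mat Bs)))) *\<^sub>Q
      (M (map sum_list Bs) :: 'k qsym))"
    by (simp only: P_scaled_def scale_sum scale_sum_const)
  also have "\<dots> = (\<Sum>Bs\<in>?D. desc_weight_list Bs *\<^sub>Q M (map sum_list Bs))"
  proof (intro sum.cong refl arg_cong2[where f = scale_qsym])
    fix Bs assume Bs: "Bs \<in> ?D"
    then have "desc_weight_list Bs = (1 / of_nat (prod_list (map z_comp Bs)) :: 'k)"
    proof -
      have "\<forall>B\<in>set Bs. sorted_wrt (\<ge>) B" using Bs by (simp add: desc_factorizations_def)
      then show ?thesis
        by (induction Bs) (simp_all add: desc_weight_list_def desc_weight_def)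
    qed
    moreover have "z_comp \<alpha> \<noteq> 0" using \<alpha> by (rule z_comp_nonzero)
    \<comment> \<open>The count cancels against \<open>z_comp \<alpha>\<close> and leaves the
      reciprocal of the product of the \<open>z_comp B\<close>.\<close>
    ultimately show "1 / of_nat (z_comp \<alpha>) * of_nat (card (row_perms (block_mat Bs))) =
        (desc_weight_list Bs :: 'k)"
      using card_row_perms_block_mat(1)[OF \<alpha> Bs] by (auto simp: field_simps)
  qed
  \<comment> \<open>The factorizations with a block that is not weakly decreasing are added, all
    with weight zero.\<close>
  also have "\<dots> = desc_powersum \<alpha>"
    unfolding desc_powersum_def
  proof (rule sum.mono_neutral_left)
    show "\<forall>Bs\<in>factorizations \<alpha> - ?D. desc_weight_list Bs *\<^sub>Q M (map sum_list Bs) = (0 :: 'k qsym)"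
    proof
      fix Bs assume "Bs \<in> factorizations \<alpha> - ?D"
      then obtain B where "B \<in> set Bs" "\<not> sorted_wrt (\<ge>) B" by (auto simp: desc_factorizations_def)
      then have "desc_weight_list Bs = (0 :: 'k)"
        by (force simp: desc_weight_list_def desc_weight_def prod_list_zero_iff)
      then show "desc_weight_list Bs *\<^sub>Q M (map sum_list Bs) = (0 :: 'k qsym)" by (simp add: scale_zero)
    qed
  qed (auto simp: desc_factorizations_def)
  finally show ?thesis .
qed

theorem theorem3p4:
  fixes \<alpha> \<beta> \<gamma> :: "nat list"
  assumes "composition \<alpha>" and "composition \<beta>" and "composition \<gamma>"
  shows "(P_scaled \<alpha> :: 'k :: field_char_0 qsym) * P_scaled \<beta> = (\<Sum>\<delta>\<in>#shuffle \<alpha> \<beta>. P_scaled \<delta>) \<and>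
    \<Delta> (P_scaled \<gamma> :: 'k qsym) = (\<Sum>(\<delta>, \<epsilon>) | \<delta> @ \<epsilon> = \<gamma>. P_scaled \<delta> \<otimes>\<^sub>Q P_scaled \<epsilon>)"
proof
  \<comment> \<open>Shuffles of compositions are compositions, so the closed form is available for
    every summand.\<close>
  have "(\<Sum>\<delta>\<in>#shuffle \<alpha> \<beta>. P_scaled \<delta> :: 'k qsym) = (\<Sum>\<delta>\<in>#shuffle \<alpha> \<beta>. desc_powersum \<delta>)"
    using assms by (intro sum_mset_cong P_scaled_eq_desc_powersum) (rule composition_shuffle)
  then show "(P_scaled \<alpha> :: 'k qsym) * P_scaled \<beta> = (\<Sum>\<delta>\<in>#shuffle \<alpha> \<beta>. P_scaled \<delta>)"
    using assms by (simp only: P_scaled_eq_desc_powersum desc_powersum_mult)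
  have "(\<Sum>(\<delta>, \<epsilon>) | \<delta> @ \<epsilon> = \<gamma>. P_scaled \<delta> \<otimes>\<^sub>Q P_scaled \<epsilon> :: 'k qsym_tensor) =
      (\<Sum>(\<delta>, \<epsilon>) | \<delta> @ \<epsilon> = \<gamma>. desc_powersum \<delta> \<otimes>\<^sub>Q desc_powersum \<epsilon>)"
    using assms(3) by (intro sum.cong refl) (auto simp: P_scaled_eq_desc_powersum)
  then show "\<Delta> (P_scaled \<gamma> :: 'k qsym) = (\<Sum>(\<delta>, \<epsilon>) | \<delta> @ \<epsilon> = \<gamma>. P_scaled \<delta> \<otimes>\<^sub>Q P_scaled \<epsilon>)"
    using assms(3) by (simp only: P_scaled_eq_desc_powersum coproduct_desc_powersum)
qed

end
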